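(* Let $\mathcal{J}$ be a Euclidean Jordan algebra of rank $r$ and dimension $k$, with an isometric linear isomorphism $\phi:\mathcal{J}\to\mathbb{R}^k$. Let $\epsilon>0$, $\delta\in(0,1)$, $\Delta_\infty>0$, and consider constraint sets $A=\{a_1,\dots,a_m\}\in\mathcal{J}^m$ normalized so that all eigenvalues of each $a_i$ lie in $[-1,1]$, and $b\in\mathbb{R}^m$. With $\alpha>0$ an accuracy parameter, put $$T=\frac{144\log r}{\alpha^2},\quad\epsilon'=\frac{\epsilon}{4\sqrt{T\log(1/\delta)}},\quad\eta=\frac{\alpha}{12},\quad\sigma=\frac{\Delta_\infty\sqrt{2r\log(T/\delta)}}{\epsilon'},\quad x^1=e/r.$$ For $t=1,\dots,T$: let $p^t\in[m]$ be the answer of a dual oracle on $(A,b,x^t)$; sample $\nu^t\sim\mathcal{N}(0,\sigma^2I_k)$ and set $z^t=\phi^{-1}(\nu^t)$, $\widehat\ell^t=\frac{a_{p^t}+z^t}{2}$, and $$x^{t+1}=\frac{\exp(-\eta\sum_{i=1}^t\widehat\ell^i)}{\mathrm{Tr}(\exp(-\eta\sum_{i=1}^t\widehat\ell^i))}.$$ Return $\overline{x}=\frac1T\sum_{t=1}^Tx^t$. If the dual oracle used is $\epsilon'$-private, then this algorithm is $(\epsilon,\delta)$-low sensitivity constraint private with sensitivity $\Delta_\infty$.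
   Context: A Euclidean Jordan algebra (EJA) is a finite-dimensional real vector space $\mathcal{J}$ with a commutative bilinear product $\circ$ satisfying $x^2\circ(x\circ y)=x\circ(x^2\circ y)$ (where $x^2=x\circ x$), an identity element $e$, and an inner product with $\langle x\circ y,z\rangle=\langle x,y\circ z\rangle$. A Jordan frame is a set $\{q_1,\dots,q_r\}$ of primitive idempotents with $q_i\circ q_j=0$ for $i\ne j$ and $\sum_i q_i=e$. Every $x\in\mathcal{J}$ has a spectral decomposition $x=\sum_{i=1}^r\lambda_i(x)q_i$ for some Jordan frame; $r$ is the rank of $\mathcal{J}$ and the $\lambda_i(x)$ are the eigenvalues. $\mathrm{Tr}(x)=\sum_i\lambda_i(x)$, $\exp(x)=\sum_ie^{\lambda_i(x)}q_i$, $\langle x,y\rangle=\mathrm{Tr}(x\circ y)$, $\|x\|_\infty=\max_i|\lambda_i(x)|$. The cone of squares is $\mathcal{K}=\{x\circ x:x\in\mathcal{J}\}$. Isometric means $\langle\phi(x),\phi(y)\rangle=\langle x,y\rangle$. Low sensitivity constraint privacy: $b$ is public, and $A,A'\in\mathcal{J}^m$ are neighboring if $\|A-A'\|_\infty:=\max_{i\in[m]}\|a_i-a_i'\|_\infty\le\Delta_\infty$. A mechanism $\mathcal{M}$ with outputs in $\mathcal{J}$ is $(\epsilon,\delta)$-low sensitivity constraint private (with sensitivity $\Delta_\infty$) if $\Pr[\mathcal{M}(b,A)\in S]\le e^\epsilon\Pr[\mathcal{M}(b,A')\in S]+\delta$ for all neighboring $A,A'$ and all $S\subseteq\mathcal{J}$.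 Dual oracle: an $(\alpha_0,\gamma)$-dual oracle, given $A\in\mathcal{J}^m$, $b\in\mathbb{R}^m$ and $x\in\mathcal{K}$, returns an index $i\in[m]$ such that $\langle a_i,x\rangle-b_i\ge\max_{j}(\langle a_j,x\rangle-b_j)-\alpha_0$ with probability at least $1-\gamma$, provided that $\max_{j}(\langle a_j,x\rangle-b_j)\ge0$. It is $\epsilon'$-private if, for each $b,x$ and neighboring $A,A'$, its output distributions satisfy $\Pr[O(A,b,x)\in S]\le e^{\epsilon'}\Pr[O(A',b,x)\in S]$ for all $S\subseteq[m]$.
   Formalization: The formal theorem adds the assumption ε ≤ 8 log(1/δ), without which the claim fails (e.g. r=2, T=2, ε=1, δ=1−10⁻⁴), and takes T to be 144 log r/α² rounded up to an integer. *)

theory Defs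
  imports "HOL-Probability.Probability"
begin

text \<open>
  The associative inner product that makes a Jordan algebra Euclidean is the one of the type class
  \<^class>\<open>euclidean_space\<close>; it also fixes the (unique) vector space topology and with it the Borel
  sets. The trace form \<open>jinner\<close> below is a further inner product, which need not be equal to it.
\<close>

locale euclidean_jordan_algebra =
  fixes jprod :: "'a::euclidean_space \<Rightarrow> 'a \<Rightarrow> 'a"  (infixl "\<odot>" 70)
    and e :: 'a
  assumes jprod_bilinear: "bilinear jprod"
    and jprod_commute: "x \<odot> y = y \<odot> x"
    and jordan_identity: "(x \<odot> x) \<odot> (x \<odot> y) = x \<odot> ((x \<odot> x) \<odot> y)"
    and jprod_unit: "e \<odot> x = x"
    and inner_jprod_assoc: "inner (x \<odot> y) z = inner x (y \<odot> z)"

context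
  fixes jprod :: "'a::euclidean_space \<Rightarrow> 'a \<Rightarrow> 'a"  (infixl "\<odot>" 70)
    and e :: 'a
begin

definition idempotent :: "'a \<Rightarrow> bool" where
  "idempotent c \<longleftrightarrow> c \<odot> c = c"

text \<open>
  No orthogonality is required of the two summands: if \<open>a\<close>, \<open>b\<close> and \<open>a + b\<close> are idempotent, then
  \<open>a \<odot> b = 0\<close>.
\<close>
definition primitive_idempotent :: "'a \<Rightarrow> bool" where
  "primitive_idempotent c \<longleftrightarrow> idempotent c \<and> c \<noteq> 0 \<and>
     \<not> (\<exists>a b. idempotent a \<and> idempotent b \<and> a \<noteq> 0 \<and> b \<noteq> 0 \<and> c = a + b)"

definition jordan_frame :: "'a set \<Rightarrow> bool" where
  "jordan_frame Q \<longleftrightarrow> finite Q \<and> (\<forall>q\<in>Q. primitive_idempotent q) \<and>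
     (\<forall>p\<in>Q. \<forall>q\<in>Q. p \<noteq> q \<longrightarrow> p \<odot> q = 0) \<and> (\<Sum>q\<in>Q. q) = e"

text \<open>All Jordan frames of a Euclidean Jordan algebra have the same cardinality, the rank.\<close>
definition has_rank :: "nat \<Rightarrow> bool" where
  "has_rank r \<longleftrightarrow> card ` {Q. jordan_frame Q} = {r}"

definition spectral_decomposition :: "'a \<Rightarrow> 'a set \<Rightarrow> ('a \<Rightarrow> real) \<Rightarrow> bool" where
  "spectral_decomposition x Q l \<longleftrightarrow> jordan_frame Q \<and> x = (\<Sum>q\<in>Q. l q *\<^sub>R q)"

text \<open>
  The eigenvalues are counted with multiplicity. Neither they nor the exponential depend on the
  spectral decomposition that is chosen.
\<close>
definition eigenvalues :: "'a \<Rightarrow> real multiset" where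
  "eigenvalues x = (SOME M. \<exists>Q l. spectral_decomposition x Q l \<and> M = image_mset l (mset_set Q))"

definition jexp :: "'a \<Rightarrow> 'a" where
  "jexp x = (SOME y. \<exists>Q l. spectral_decomposition x Q l \<and> y = (\<Sum>q\<in>Q. exp (l q) *\<^sub>R q))"

definition jtrace :: "'a \<Rightarrow> real" where
  "jtrace x = sum_mset (eigenvalues x)"

definition jinner :: "'a \<Rightarrow> 'a \<Rightarrow> real" where
  "jinner x y = jtrace (x \<odot> y)"

definition norm_infty :: "'a \<Rightarrow> real" where
  "norm_infty x = Max (abs ` set_mset (eigenvalues x))"

definition square_cone :: "'a set" where
  "square_cone = range (\<lambda>x. x \<odot> x)"

text \<open>
  A constraint set is a family indexed by a finite type \<open>'m\<close>, which plays the role of the index set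
  with \<open>m\<close> elements.
\<close>
definition normalized_constraints :: "('m::finite \<Rightarrow> 'a) set" where
  "normalized_constraints = {A. \<forall>i. set_mset (eigenvalues (A i)) \<subseteq> {-1..1}}"

definition neighboring :: "real \<Rightarrow> ('m::finite \<Rightarrow> 'a) \<Rightarrow> ('m \<Rightarrow> 'a) \<Rightarrow> bool" where
  "neighboring \<Delta> A A' \<longleftrightarrow> (MAX i. norm_infty (A i - A' i)) \<le> \<Delta>"

text \<open>
  A mechanism assigns to each \<open>b\<close> and each admissible \<open>A \<in> \<A>\<close> a Borel probability distribution; the
  events are the Borel sets.
\<close>
definition low_sensitivity_constraint_private ::
    "('m::finite \<Rightarrow> 'a) set \<Rightarrow> real \<Rightarrow> real \<Rightarrow> real \<Rightarrow>
     (('m \<Rightarrow> real) \<Rightarrow> ('m \<Rightarrow> 'a) \<Rightarrow> 'a measure) \<Rightarrow> bool" where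
  "low_sensitivity_constraint_private \<A> \<Delta> \<epsilon> \<delta> M \<longleftrightarrow>
     (\<forall>b. \<forall>A\<in>\<A>. prob_space (M b A) \<and> sets (M b A) = sets borel) \<and>
     (\<forall>b. \<forall>A\<in>\<A>. \<forall>A'\<in>\<A>. neighboring \<Delta> A A' \<longrightarrow>
        (\<forall>S\<in>sets borel. measure (M b A) S \<le> exp \<epsilon> * measure (M b A') S + \<delta>))"

text \<open>
  The first conjunct says that a randomized oracle is a Markov kernel in the query point, without
  which the distribution of an adaptive sequence of calls is undefined. It is no restriction that it
  is imposed on all of \<open>'a\<close> instead of only on the cone, since the cone is closed.
\<close>
definition dual_oracle ::
    "('m::finite \<Rightarrow> 'a) set \<Rightarrow> real \<Rightarrow> real \<Rightarrow>
     (('m \<Rightarrow> 'a) \<Rightarrow> ('m \<Rightarrow> real) \<Rightarrow> 'a \<Rightarrow> 'm pmf) \<Rightarrow> bool" where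
  "dual_oracle \<A> \<alpha>\<^sub>0 \<gamma> Orc \<longleftrightarrow>
     (\<forall>A\<in>\<A>. \<forall>b i. (\<lambda>x. pmf (Orc A b x) i) \<in> borel_measurable borel) \<and>
     (\<forall>A\<in>\<A>. \<forall>b. \<forall>x\<in>square_cone. (MAX j. jinner (A j) x - b j) \<ge> 0 \<longrightarrow>
        measure_pmf.prob (Orc A b x)
          {i. jinner (A i) x - b i \<ge> (MAX j. jinner (A j) x - b j) - \<alpha>\<^sub>0} \<ge> 1 - \<gamma>)"

definition private_oracle ::
    "('m::finite \<Rightarrow> 'a) set \<Rightarrow> real \<Rightarrow> real \<Rightarrow>
     (('m \<Rightarrow> 'a) \<Rightarrow> ('m \<Rightarrow> real) \<Rightarrow> 'a \<Rightarrow> 'm pmf) \<Rightarrow> bool" where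
  "private_oracle \<A> \<Delta> \<epsilon>' Orc \<longleftrightarrow>
     (\<forall>b. \<forall>x\<in>square_cone. \<forall>A\<in>\<A>. \<forall>A'\<in>\<A>. neighboring \<Delta> A A' \<longrightarrow>
        (\<forall>S. measure_pmf.prob (Orc A b x) S \<le> exp \<epsilon>' * measure_pmf.prob (Orc A' b x) S))"

definition isometric_iso :: "('a \<Rightarrow> real ^ 'k::finite) \<Rightarrow> bool" where
  "isometric_iso \<phi> \<longleftrightarrow> linear \<phi> \<and> bij \<phi> \<and> (\<forall>x y. inner (\<phi> x) (\<phi> y) = jinner x y)"

text \<open>The normal distribution with mean \<open>0\<close> and covariance \<open>\<sigma>\<^sup>2\<close> times the identity.\<close>
definition gaussian :: "real \<Rightarrow> (real ^ 'k::finite) measure" where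
  "gaussian \<sigma> = density lborel (\<lambda>v. ennreal (\<Prod>i\<in>UNIV. normal_density 0 \<sigma> (v $ i)))"

definition gibbs :: "real \<Rightarrow> 'a \<Rightarrow> 'a" where
  "gibbs \<eta> s = (1 / jtrace (jexp (- \<eta> *\<^sub>R s))) *\<^sub>R jexp (- \<eta> *\<^sub>R s)"

text \<open>
  The state before round \<open>t\<close> is the triple of the sum of the noisy losses of the rounds \<open>i < t\<close>, the
  sum of the iterates of the rounds \<open>i < t\<close>, and the iterate of round \<open>t\<close>.
\<close>
definition mwu_round ::
    "('a \<Rightarrow> real ^ 'k::finite) \<Rightarrow> (('m::finite \<Rightarrow> 'a) \<Rightarrow> ('m \<Rightarrow> real) \<Rightarrow> 'a \<Rightarrow> 'm pmf) \<Rightarrow>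
     real \<Rightarrow> real \<Rightarrow> ('m \<Rightarrow> real) \<Rightarrow> ('m \<Rightarrow> 'a) \<Rightarrow> 'a \<times> 'a \<times> 'a \<Rightarrow> ('a \<times> 'a \<times> 'a) measure" where
  "mwu_round \<phi> Orc \<eta> \<sigma> b A = (\<lambda>(s, xsum, x).
     measure_pmf (Orc A b x) \<bind> (\<lambda>p.
     gaussian \<sigma> \<bind> (\<lambda>\<nu>.
       let s' = s + (1 / 2) *\<^sub>R (A p + inv \<phi> \<nu>)
       in return borel (s', xsum + x, gibbs \<eta> s'))))"

primrec mwu_state ::
    "('a \<Rightarrow> real ^ 'k::finite) \<Rightarrow> (('m::finite \<Rightarrow> 'a) \<Rightarrow> ('m \<Rightarrow> real) \<Rightarrow> 'a \<Rightarrow> 'm pmf) \<Rightarrow>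
     nat \<Rightarrow> real \<Rightarrow> real \<Rightarrow> ('m \<Rightarrow> real) \<Rightarrow> ('m \<Rightarrow> 'a) \<Rightarrow> nat \<Rightarrow> ('a \<times> 'a \<times> 'a) measure" where
  "mwu_state \<phi> Orc r \<eta> \<sigma> b A 0 = return borel (0, 0, (1 / real r) *\<^sub>R e)"
| "mwu_state \<phi> Orc r \<eta> \<sigma> b A (Suc t) =
     mwu_state \<phi> Orc r \<eta> \<sigma> b A t \<bind> mwu_round \<phi> Orc \<eta> \<sigma> b A"

definition private_mwu ::
    "('a \<Rightarrow> real ^ 'k::finite) \<Rightarrow> (('m::finite \<Rightarrow> 'a) \<Rightarrow> ('m \<Rightarrow> real) \<Rightarrow> 'a \<Rightarrow> 'm pmf) \<Rightarrow>
     nat \<Rightarrow> nat \<Rightarrow> real \<Rightarrow> real \<Rightarrow> ('m \<Rightarrow> real) \<Rightarrow> ('m \<Rightarrow> 'a) \<Rightarrow> 'a measure" where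
  "private_mwu \<phi> Orc r T \<eta> \<sigma> b A =
     distr (mwu_state \<phi> Orc r \<eta> \<sigma> b A T) borel (\<lambda>(s, xsum, x). (1 / real T) *\<^sub>R xsum)"

end

end

theory Submission
  imports Defs
begin

text \<open>
  Privacy is accounted for by Renyi divergence. For an order \<open>\<alpha> > 1\<close>, the statement that the divergence
  of \<open>M\<close> from \<open>N\<close> is at most \<open>\<alpha> \<rho>\<close> is used in its dual form \<open>renyi_bound\<close>, an inequality between
  integrals of test functions with values in \<open>[0,1]\<close>. In this form the two properties that the
  argument needs are immediate: the bound survives post-processing, and along two Markov kernels
  the \<open>\<rho>\<close> of the rounds add up (\<open>renyi_bound_bind\<close>), so that no density of the joint distribution of
  the rounds is ever formed. Young's inequality turns the bound back into \<open>(\<epsilon>, \<delta>)\<close>-privacy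
  (\<open>renyi_bound_imp_dp\<close>).

  One round costs at most \<open>\<rho> = \<epsilon>'\<^sup>2\<close>. The oracle call contributes \<open>\<epsilon>'\<^sup>2 / 2\<close> (\<open>renyi_bound_pure_dp\<close>,
  two applications of Hoeffding's lemma to the log-likelihood ratio). The Gaussian noise contributes
  \<open>s\<^sup>2 / (2 \<sigma>\<^sup>2)\<close>, where \<open>s\<close> is the distance of the two possible losses for the trace form
  (\<open>renyi_bound_gaussian\<close>); as \<open>s\<^sup>2 \<le> r \<Delta>\<^sup>2\<close> this is \<open>\<epsilon>'\<^sup>2 / (4 ln (T / \<delta>))\<close>, which is at most
  \<open>\<epsilon>'\<^sup>2 / 2\<close> once \<open>T \<ge> 2\<close>. The noise of the last round does not reach the average of the iterates
  (\<open>private_mwu_Suc\<close>); for \<open>T \<le> 1\<close> the output is therefore a constant, and otherwise the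
  total cost is below \<open>T \<epsilon>'\<^sup>2 = \<epsilon>\<^sup>2 / (16 L)\<close> with \<open>L = ln (1 / \<delta>)\<close>. The order \<open>\<alpha> = 1 + 4 L / \<epsilon>\<close> then
  yields \<open>(\<epsilon>, \<delta>)\<close>-privacy, because \<open>\<epsilon> \<le> 8 L\<close> (\<open>dp_parameters\<close>).

  The Jordan algebra enters in three places, and each rests on the existence of spectral
  decompositions (\<open>spectral_decomposition_exists\<close>): the iterates lie in the cone of squares, where
  the oracle is private; they depend measurably on the accumulated loss, since the exponential is
  the limit of its power series; and the trace of the square of an element is at most \<open>r\<close> times the
  square of its largest absolute eigenvalue. That the trace, defined through a choice of eigenvalues,
  is linear follows from the isometry \<open>\<phi>\<close>, under which the trace form is an inner product.
\<close>

section \<open>Spectral decompositions in Euclidean Jordan algebras\<close>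

text \<open>
  The form \<open>(u, v) \<mapsto> \<langle>B u, v\<rangle>\<close> has a minimum at a null vector \<open>u\<close>, so its first variation there, which is
  twice \<open>\<langle>B u, h\<rangle>\<close> in the direction \<open>h\<close>, vanishes.
\<close>
lemma psd_null_direction:
  fixes B :: "'a::real_inner \<Rightarrow> 'a"
  assumes B: "linear B" and V: "subspace V"
    and sym: "\<And>u v. u \<in> V \<Longrightarrow> v \<in> V \<Longrightarrow> inner (B u) v = inner u (B v)"
    and psd: "\<And>u. u \<in> V \<Longrightarrow> inner (B u) u \<ge> 0"
    and u: "u \<in> V" "inner (B u) u = 0" and h: "h \<in> V"
  shows "inner (B u) h = 0"
proof (rule ccontr)
  define b where "b = inner (B u) h"
  define c where "c = inner (B h) h"
  \<comment> \<open>a step that makes the quadratic polynomial \<open>2 * t * b + t\<^sup>2 * c\<close> negative, also when \<open>c = 0\<close>\<close>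
  define t where "t = - b / (c + 1)"
  assume "inner (B u) h \<noteq> 0"
  then have b: "b \<noteq> 0" by (simp add: b_def)
  have c: "c \<ge> 0" using psd[OF h] by (simp add: c_def)
  have "inner (B h) u = b"
    using sym[OF h u(1)] by (simp add: b_def inner_commute)
  then have "inner (B (u + t *\<^sub>R h)) (u + t *\<^sub>R h) = 2 * t * b + t\<^sup>2 * c"
    using u by (simp add: linear_add[OF B] linear_cmul[OF B] inner_add_left inner_add_right
        b_def c_def power2_eq_square algebra_simps)
  also have "\<dots> = - (t\<^sup>2 * (c + 2))"
  proof -
    have "b = - t * (c + 1)" using c by (simp add: t_def)
    then show ?thesis unfolding power2_eq_square by algebra
  qed
  also have "\<dots> < 0"
    using b c by (simp add: t_def)
  finally show False
    using psd[of "u + t *\<^sub>R h"] u h V by (simp add: subspace_add subspace_scale not_le[symmetric])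
qed

text \<open>
  A maximizer \<open>u\<close> of the Rayleigh quotient on the unit sphere of \<open>V\<close>, with maximum \<open>l\<close>, is a null vector of
  the positive semidefinite operator \<open>l - B\<close>.
\<close>
lemma selfadjoint_eigenvector:
  fixes B :: "'a::euclidean_space \<Rightarrow> 'a"
  assumes B: "linear B" and V: "subspace V" and BV: "\<And>u. u \<in> V \<Longrightarrow> B u \<in> V"
    and sym: "\<And>u v. u \<in> V \<Longrightarrow> v \<in> V \<Longrightarrow> inner (B u) v = inner u (B v)"
    and c: "c \<in> V" "c \<noteq> 0"
  obtains u l where "u \<in> V" "u \<noteq> 0" "B u = l *\<^sub>R u"
proof -
  have "compact (sphere 0 1 \<inter> V)"
    using V by (simp add: closed_subspace compact_Int_closed)
  moreover have "(1 / norm c) *\<^sub>R c \<in> sphere 0 1 \<inter> V"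
    using c V by (simp add: subspace_scale)
  moreover have "continuous_on (sphere 0 1 \<inter> V) (\<lambda>u. inner (B u) u)"
    by (intro continuous_intros linear_continuous_on linear_conv_bounded_linear[THEN iffD1] B)
  ultimately obtain u where u: "u \<in> sphere 0 1 \<inter> V"
    and max: "\<And>v. v \<in> sphere 0 1 \<inter> V \<Longrightarrow> inner (B v) v \<le> inner (B u) u"
    using continuous_attains_sup[of "sphere 0 1 \<inter> V" "\<lambda>u. inner (B u) u"] by blast
  define l where "l = inner (B u) u"
  define C where "C = (\<lambda>v. l *\<^sub>R v - B v)"
  have C: "linear C"
    unfolding C_def by (intro linear_compose_sub B linear_compose_scale_right linear_ident)
  have CV: "C v \<in> V" if "v \<in> V" for v
    using that V BV by (simp add: C_def subspace_diff subspace_scale)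
  have psd: "inner (C v) v \<ge> 0" if v: "v \<in> V" for v
  proof (cases "v = 0")
    case False
    have "inner (B ((1 / norm v) *\<^sub>R v)) ((1 / norm v) *\<^sub>R v) \<le> l"
      unfolding l_def using False v V by (intro max) (simp add: subspace_scale)
    then show ?thesis
      using False by (simp add: linear_cmul[OF B] C_def inner_diff_left field_simps
          power2_eq_square flip: power2_norm_eq_inner)
  qed simp
  have "inner u u = 1"
    using u by (simp add: norm_eq_1)
  then have "inner (C u) u = 0"
    by (simp add: C_def l_def inner_diff_left)
  moreover have "inner (C v) w = inner v (C w)" if "v \<in> V" "w \<in> V" for v w
    using sym[OF that] by (simp add: C_def inner_diff_left inner_diff_right)
  ultimately have "inner (C u) (C u) = 0"
    using u CV[of u] psd_null_direction[OF C V, of u "C u"] psd by simp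
  then have "B u = l *\<^sub>R u"
    by (simp add: C_def)
  moreover have "u \<noteq> 0" using u by auto
  ultimately show ?thesis using that u by auto
qed

context euclidean_jordan_algebra
begin

lemmas jprod_linear =
  bilinear_ladd[OF jprod_bilinear] bilinear_radd[OF jprod_bilinear]
  bilinear_lsub[OF jprod_bilinear] bilinear_rsub[OF jprod_bilinear]
  bilinear_lmul[OF jprod_bilinear] bilinear_rmul[OF jprod_bilinear]
  bilinear_lneg[OF jprod_bilinear] bilinear_rneg[OF jprod_bilinear]
  bilinear_lzero[OF jprod_bilinear] bilinear_rzero[OF jprod_bilinear]

lemma jprod_unit_right: "x \<odot> e = x"
  using jprod_unit jprod_commute by metis

lemma linear_jprod: "linear ((\<odot>) x)" "linear (\<lambda>y. y \<odot> x)"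
  using jprod_bilinear by (auto simp: bilinear_def)

lemmas jprod_sum = linear_sum[OF linear_jprod(1)] linear_sum[OF linear_jprod(2)]

lemma jprod_selfadjoint: "inner (c \<odot> a) b = inner a (c \<odot> b)"
  by (metis inner_jprod_assoc jprod_commute)

lemma unit_nonzero: "e \<noteq> 0"
proof
  assume "e = 0"
  then have "x = 0" for x :: 'a
    using jprod_unit[of x] by (simp add: jprod_linear)
  then show False
    using SOME_Basis nonzero_Basis by blast
qed

text \<open>
  This is the full polarization of the Jordan identity, a cubic identity in \<open>x\<close> for fixed \<open>w\<close>: the
  alternating sum of its values at the partial sums of \<open>x\<close>, \<open>y\<close>, \<open>z\<close> leaves only the part that is linear in each.
\<close>
lemma jordan_identity_linearized:
  "x \<odot> ((y \<odot> z) \<odot> w) + y \<odot> ((z \<odot> x) \<odot> w) + z \<odot> ((x \<odot> y) \<odot> w) =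
   (y \<odot> z) \<odot> (x \<odot> w) + (z \<odot> x) \<odot> (y \<odot> w) + (x \<odot> y) \<odot> (z \<odot> w)"
proof -
  define F where "F x = x \<odot> ((x \<odot> x) \<odot> w) - (x \<odot> x) \<odot> (x \<odot> w)" for x
  have F: "F x = 0" for x
    by (simp add: F_def jordan_identity)
  have "F (x + y + z) - F (x + y) - F (y + z) - F (z + x) + F x + F y + F z =
    2 *\<^sub>R (x \<odot> ((y \<odot> z) \<odot> w) + y \<odot> ((z \<odot> x) \<odot> w) + z \<odot> ((x \<odot> y) \<odot> w) -
      ((y \<odot> z) \<odot> (x \<odot> w) + (z \<odot> x) \<odot> (y \<odot> w) + (x \<odot> y) \<odot> (z \<odot> w)))"
    unfolding F_def jprod_linear scaleR_2
    by (simp add: jprod_linear jprod_commute[of z y] jprod_commute[of z x] jprod_commute[of y x]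
         algebra_simps)
  then show ?thesis by (simp add: F)
qed

text \<open>
  The right-hand side of the linearized identity is symmetric in all four elements, so the left-hand
  side does not change when \<open>x\<close> and \<open>w\<close> are exchanged. Comparing both versions expresses multiplication
  by a triple product through multiplications by simpler elements.
\<close>
lemma jprod_of_product:
  "(x \<odot> (y \<odot> z)) \<odot> w = x \<odot> ((y \<odot> z) \<odot> w) + y \<odot> ((z \<odot> x) \<odot> w) + z \<odot> ((x \<odot> y) \<odot> w)
     - y \<odot> (x \<odot> (z \<odot> w)) - z \<odot> (x \<odot> (y \<odot> w))"
proof -
  have "x \<odot> ((y \<odot> z) \<odot> w) + y \<odot> ((z \<odot> x) \<odot> w) + z \<odot> ((x \<odot> y) \<odot> w) =
        w \<odot> ((y \<odot> z) \<odot> x) + y \<odot> ((z \<odot> w) \<odot> x) + z \<odot> ((w \<odot> y) \<odot> x)"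
    unfolding jordan_identity_linearized by (simp add: jprod_commute add_ac)
  then show ?thesis by (simp add: jprod_commute)
qed

definition jpow :: "'a \<Rightarrow> nat \<Rightarrow> 'a" where
  "jpow x n = ((\<odot>) x ^^ n) e"

lemma jpow_0 [simp]: "jpow x 0 = e" and jpow_Suc [simp]: "jpow x (Suc n) = x \<odot> jpow x n"
  by (simp_all add: jpow_def)

text \<open>
  For \<open>y = x\<close> and \<open>z = x\<^sup>n\<close> the previous lemma is a recursion that expresses multiplication by \<open>x\<^sup>n\<^sup>+\<^sup>2\<close>
  through multiplications by \<open>x\<close>, \<open>x\<^sup>2\<close>, \<open>x\<^sup>n\<close> and \<open>x\<^sup>n\<^sup>+\<^sup>1\<close>. Commutation with \<open>x\<^sup>2\<close> has to be carried along in the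
  induction; power associativity, the next lemma, needs only commutation with \<open>x\<close>.
\<close>
lemma jpow_mult_commutes:
  "(\<forall>w. jpow x n \<odot> (x \<odot> w) = x \<odot> (jpow x n \<odot> w)) \<and>
   (\<forall>w. jpow x n \<odot> ((x \<odot> x) \<odot> w) = (x \<odot> x) \<odot> (jpow x n \<odot> w))"
proof (induction n rule: induct_nat_012)
  case 0
  show ?case by (simp add: jprod_unit)
next
  case 1
  show ?case by (simp add: jprod_unit_right jordan_identity)
next
  case (ge2 n)
  have rec: "jpow x (Suc (Suc n)) \<odot> w = 2 *\<^sub>R (x \<odot> (jpow x (Suc n) \<odot> w))
    + jpow x n \<odot> ((x \<odot> x) \<odot> w) - x \<odot> (x \<odot> (jpow x n \<odot> w)) - jpow x n \<odot> (x \<odot> (x \<odot> w))" for w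
    using jprod_of_product[of x x "jpow x n" w]
    by (simp add: scaleR_2 jprod_commute[of "jpow x n" x])
  show ?case
    using ge2 by (simp add: rec jprod_linear jordan_identity del: jpow_Suc)
qed

lemma jpow_add: "jpow x m \<odot> jpow x n = jpow x (m + n)"
  by (induction n) (simp_all add: jprod_unit_right jpow_mult_commutes)

definition jalg :: "'a \<Rightarrow> 'a set" where
  "jalg x = span (range (jpow x))"

lemma jalg_subspace: "subspace (jalg x)"
  by (simp add: jalg_def)

lemma jalg_unit: "e \<in> jalg x" and jalg_generator: "x \<in> jalg x"
proof -
  have "jpow x 0 \<in> jalg x" "jpow x 1 \<in> jalg x"
    unfolding jalg_def by (rule span_base, rule rangeI)+
  then show "e \<in> jalg x" "x \<in> jalg x" by (simp_all add: jprod_unit_right)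
qed

lemma jalg_jprod:
  assumes "u \<in> jalg x" "v \<in> jalg x"
  shows "u \<odot> v \<in> jalg x"
  using assms(1) unfolding jalg_def
proof (induction rule: span_induct)
  case base
  show ?case by (auto simp: subspace_def jprod_linear span_zero span_add span_scale)
next
  case (step u)
  then obtain m where m: "u = jpow x m" by auto
  show ?case using assms(2) unfolding jalg_def
  proof (induction rule: span_induct)
    case base
    show ?case by (auto simp: subspace_def jprod_linear span_zero span_add span_scale)
  next
    case (step v)
    then show ?case by (auto simp: m jpow_add intro: span_base)
  qed
qed

lemma jalg_assoc:
  assumes "u \<in> jalg x" "v \<in> jalg x" "w \<in> jalg x"
  shows "(u \<odot> v) \<odot> w = u \<odot> (v \<odot> w)"
  using assms(1) unfolding jalg_def
proof (induction rule: span_induct)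
  case base
  show ?case by (auto simp: subspace_def jprod_linear)
next
  case (step u)
  then obtain m where m: "u = jpow x m" by auto
  show ?case using assms(2) unfolding jalg_def
  proof (induction rule: span_induct)
    case base
    show ?case by (auto simp: subspace_def jprod_linear)
  next
    case (step v)
    then obtain n where n: "v = jpow x n" by auto
    show ?case using assms(3) unfolding jalg_def
    proof (induction rule: span_induct)
      case base
      show ?case by (auto simp: subspace_def jprod_linear)
    next
      case (step v)
      then show ?case by (auto simp: m n jpow_add add_ac)
    qed
  qed
qed

text \<open>
  A partial Jordan frame. Completeness (sum \<open>e\<close>) is imposed separately, and primitivity is obtained
  by taking systems that are as large as possible.
\<close>
definition orth_system :: "'a set \<Rightarrow> bool" where
  "orth_system S \<longleftrightarrow> (\<forall>q\<in>S. idempotent jprod q \<and> q \<noteq> 0) \<and> (\<forall>p\<in>S. \<forall>q\<in>S. p \<noteq> q \<longrightarrow> p \<odot> q = 0)"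

text \<open>
  Idempotents with product \<open>0\<close> are orthogonal for the associative inner product, hence linearly
  independent.
\<close>
lemma orth_system_card:
  assumes "orth_system S"
  shows "finite S" "card S \<le> DIM('a)"
proof -
  have "inner p q = 0" if "p \<in> S" "q \<in> S" "p \<noteq> q" for p q
  proof -
    have "inner p q = inner (p \<odot> p) q" using assms that by (simp add: orth_system_def idempotent_def)
    also have "\<dots> = 0" using assms that by (simp add: inner_jprod_assoc orth_system_def)
    finally show ?thesis .
  qed
  then have "independent S"
    using assms by (intro pairwise_orthogonal_independent)
      (auto simp: pairwise_def orthogonal_def orth_system_def)
  then show "finite S" "card S \<le> DIM('a)" using independent_bound by auto
qed

lemma orth_system_split:
  assumes S: "orth_system S" "c \<in> S" and c: "c = f + g" "f \<odot> g = 0"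
    and f: "idempotent jprod f" "f \<noteq> 0" and g: "idempotent jprod g" "g \<noteq> 0"
    and orth: "\<And>q. q \<in> S \<Longrightarrow> q \<noteq> c \<Longrightarrow> q \<odot> f = 0 \<and> q \<odot> g = 0"
  defines "S' \<equiv> insert f (insert g (S - {c}))"
  shows "orth_system S'" "card S' = Suc (card S)" "\<Sum>S' = \<Sum>S"
proof -
  note fin = orth_system_card(1)[OF S(1)]
  have fg: "f \<noteq> g" using c f by (auto simp: idempotent_def)
  have nf: "f \<notin> S - {c}" using orth[of f] f by (auto simp: idempotent_def)
  have ng: "g \<notin> S - {c}" using orth[of g] g by (auto simp: idempotent_def)
  have "f \<odot> q = 0 \<and> g \<odot> q = 0" if "q \<in> S" "q \<noteq> c" for q
    using orth[OF that] by (simp add: jprod_commute)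
  then show "orth_system S'"
    using S c f g orth jprod_commute[of g f] by (auto simp: orth_system_def S'_def)
  show "card S' = Suc (card S)"
    using fin fg nf ng S(2) by (simp add: S'_def card.insert_remove card_Suc_Diff1 del: card_Diff_insert)
  have "\<Sum>S' = f + (g + \<Sum>(S - {c}))"
    using fin fg nf ng by (simp add: S'_def)
  also have "\<dots> = \<Sum>S"
    using c fin S(2) by (simp add: sum.remove)
  finally show "\<Sum>S' = \<Sum>S" .
qed

lemma orth_system_max:
  assumes "orth_system S0" "P S0"
  shows "\<exists>S. orth_system S \<and> P S \<and> (\<forall>S'. orth_system S' \<and> P S' \<longrightarrow> card S' \<le> card S)"
proof -
  have "\<exists>S. (orth_system S \<and> P S) \<and> (\<forall>S'. orth_system S' \<and> P S' \<longrightarrow> card S' \<le> card S)"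
    using assms orth_system_card(2)
    by (intro ex_has_greatest_nat[where b = "Suc (DIM('a))" and k = S0])
       (auto simp: less_Suc_eq_le)
  then show ?thesis by (simp only: conj_assoc)
qed

text \<open>
  Multiplication by \<open>x\<close> is self-adjoint on the ideal \<open>V = c \<odot> jalg x\<close> and so has an eigenvector there. Its
  eigenspace \<open>I\<close> is an ideal of the associative algebra \<open>jalg x\<close>, and so is the orthogonal complement of \<open>I\<close>
  in \<open>V\<close>. The components of \<open>c\<close> along the two ideals are orthogonal idempotents; neither is \<open>0\<close> because
  \<open>I\<close> is nonzero and \<open>c\<close> is not an eigenvector.
\<close>
lemma jalg_idempotent_split:
  assumes c: "c \<in> jalg x" "idempotent jprod c" "c \<noteq> 0" and nonscalar: "\<And>l. x \<odot> c \<noteq> l *\<^sub>R c"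
  obtains f g where "f \<in> jalg x" "g \<in> jalg x" "c = f + g" "f \<odot> g = 0"
    "idempotent jprod f" "f \<noteq> 0" "idempotent jprod g" "g \<noteq> 0"
proof -
  let ?W = "jalg x"
  note W = jalg_subspace[of x] and xW = jalg_generator[of x]
  define V where "V = {v \<in> ?W. c \<odot> v = v}"
  have V: "subspace V"
    using W by (auto simp: V_def subspace_def jprod_linear)
  have cc: "c \<odot> c = c" using c by (simp add: idempotent_def)
  have cV: "c \<in> V" using c cc by (simp add: V_def)
  have VV: "v \<odot> w \<in> V" if "v \<in> V" "w \<in> ?W" for v w
    using that jalg_assoc[of c x v w] c by (auto simp: V_def jalg_jprod)
  have xV: "x \<odot> v \<in> V" if "v \<in> V" for v
    using VV[OF that xW] by (simp add: jprod_commute)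
  obtain u l where u: "u \<in> V" "u \<noteq> 0" "x \<odot> u = l *\<^sub>R u"
    by (rule selfadjoint_eigenvector[OF linear_jprod(1)[of x] V xV jprod_selfadjoint cV c(3)])
  define I where "I = {v \<in> V. x \<odot> v = l *\<^sub>R v}"
  have I: "subspace I"
    using V by (auto simp: I_def subspace_def jprod_linear scaleR_add_right)
  have IV: "v \<odot> w \<in> I" if "v \<in> I" "w \<in> ?W" for v w
    using that VV jalg_assoc[of x x v w] xW by (auto simp: I_def V_def jprod_linear)
  obtain f g where fg: "f \<in> span I" "\<And>w. w \<in> span I \<Longrightarrow> orthogonal g w" "c = f + g"
    using orthogonal_subspace_decomp_exists[of I c] by blast
  have f: "f \<in> I" and g: "\<And>w. w \<in> I \<Longrightarrow> inner g w = 0"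
    using fg(1) I fg(2)[OF span_base] unfolding orthogonal_def by (simp_all add: span_eq_iff[THEN iffD2])
  have fV: "f \<in> V" "f \<in> ?W" using f by (auto simp: I_def V_def)
  have g_eq: "g = c - f" using fg by simp
  have gV: "g \<in> V" "g \<in> ?W"
    using subspace_diff[OF V cV fV(1)] by (simp_all add: g_eq V_def)
  have fg0: "f \<odot> g = 0"
  proof -
    have fgW: "f \<odot> g \<in> ?W" using fV gV by (simp add: jalg_jprod)
    have "inner (f \<odot> g) (f \<odot> g) = inner g (f \<odot> (f \<odot> g))"
      by (simp add: jprod_commute[of f g] inner_jprod_assoc)
    also have "\<dots> = 0" using IV[OF f fgW] by (rule g)
    finally show ?thesis by simp
  qed
  have "f \<odot> c = f" using fV by (simp add: V_def jprod_commute)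
  then have ff: "f \<odot> f = f" using fg0 fg(3) by (simp add: jprod_linear)
  have "g \<odot> c = g" using gV by (simp add: V_def jprod_commute)
  then have gg: "g \<odot> g = g" using fg0 fg(3) by (simp add: jprod_linear jprod_commute[of g f])
  have "f \<noteq> 0"
  proof
    assume "f = 0"
    then have "inner c (u \<odot> u) = 0"
      using g[of "u \<odot> u"] IV[of u u] u fg(3) by (simp add: I_def V_def)
    then have "inner (c \<odot> u) u = 0" by (simp add: inner_jprod_assoc)
    then show False using u by (simp add: V_def)
  qed
  moreover have "g \<noteq> 0"
    using f fg(3) nonscalar[of l] by (auto simp: I_def)
  ultimately show ?thesis
    using that[OF fV(2) gV(2) fg(3) fg0] ff gg by (simp add: idempotent_def)
qed

text \<open>
  On the members of a maximal complete orthogonal system inside \<open>jalg x\<close>, multiplication by \<open>x\<close> has to be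
  scalar, since otherwise the system could be refined.
\<close>
lemma spectral_idempotents_exist:
  obtains S l where "orth_system S" "\<Sum>S = e" "x = (\<Sum>q\<in>S. l q *\<^sub>R q)"
proof -
  have "orth_system {e}" "{e} \<subseteq> jalg x \<and> \<Sum>{e} = e"
    using jalg_unit unit_nonzero by (auto simp: orth_system_def idempotent_def jprod_unit)
  then have "\<exists>S. orth_system S \<and> (S \<subseteq> jalg x \<and> \<Sum>S = e) \<and>
    (\<forall>S'. orth_system S' \<and> (S' \<subseteq> jalg x \<and> \<Sum>S' = e) \<longrightarrow> card S' \<le> card S)"
    by (rule orth_system_max)
  then obtain S where S: "orth_system S" "S \<subseteq> jalg x \<and> \<Sum>S = e"
    and max: "\<forall>S'. orth_system S' \<and> (S' \<subseteq> jalg x \<and> \<Sum>S' = e) \<longrightarrow> card S' \<le> card S"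
    by (elim exE conjE) (rule that; simp)
  have "\<exists>l. x \<odot> c = l *\<^sub>R c" if c: "c \<in> S" for c
  proof (rule ccontr)
    assume ns: "\<nexists>l. x \<odot> c = l *\<^sub>R c"
    have c': "c \<in> jalg x" "idempotent jprod c" "c \<noteq> 0"
      using S c by (auto simp: orth_system_def)
    obtain f g where fg: "f \<in> jalg x" "g \<in> jalg x" "c = f + g" "f \<odot> g = 0"
      "idempotent jprod f" "f \<noteq> 0" "idempotent jprod g" "g \<noteq> 0"
      using jalg_idempotent_split[OF c'] ns by blast
    have cfg: "c \<odot> f = f" "c \<odot> g = g"
      using fg by (auto simp: jprod_linear idempotent_def jprod_commute[of g f])
    have orth: "q \<odot> f = 0 \<and> q \<odot> g = 0" if q: "q \<in> S" "q \<noteq> c" for q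
    proof -
      have "q \<odot> c = 0" using S c q by (simp add: orth_system_def)
      then show ?thesis
        using jalg_assoc[of q x c f] jalg_assoc[of q x c g] c' fg q S cfg
        by (auto simp: jprod_linear)
    qed
    let ?S' = "insert f (insert g (S - {c}))"
    have "orth_system ?S'" "card ?S' = Suc (card S)" "\<Sum>?S' = \<Sum>S"
      using orth_system_split[OF S(1) c fg(3-8)] orth by blast+
    moreover have "?S' \<subseteq> jalg x" using S fg by blast
    ultimately show False
      using max[rule_format, of ?S'] S by simp
  qed
  then obtain l where l: "\<And>c. c \<in> S \<Longrightarrow> x \<odot> c = l c *\<^sub>R c" by metis
  have "x = x \<odot> \<Sum>S" using S by (simp add: jprod_unit_right)
  also have "\<dots> = (\<Sum>q\<in>S. l q *\<^sub>R q)" by (simp add: jprod_sum l)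
  finally show ?thesis using that[OF S(1)] S by blast
qed

text \<open>
  Peirce's cubic: multiplication by an idempotent has no eigenvalues besides \<open>0\<close>, \<open>1/2\<close> and \<open>1\<close>.
\<close>
lemma idempotent_mult_cubic:
  assumes "idempotent jprod c"
  shows "c \<odot> w = 3 *\<^sub>R (c \<odot> (c \<odot> w)) - 2 *\<^sub>R (c \<odot> (c \<odot> (c \<odot> w)))"
proof -
  have "3 *\<^sub>R v = v + v + v" for v :: 'a
    using scaleR_add_left[of 1 2 v] by (simp add: scaleR_2 add_ac)
  then show ?thesis
    using jprod_of_product[of c c c w] assms by (simp add: idempotent_def scaleR_2 diff_diff_eq)
qed

text \<open>
  By the cubic, \<open>2 L\<^sup>2 - L\<close> and \<open>4 L - 4 L\<^sup>2\<close> are the projections onto the eigenspaces of \<open>L = (\<odot>) c\<close> for the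
  eigenvalues \<open>1\<close> and \<open>1/2\<close>. The vectors \<open>P1\<close> and \<open>P2\<close> of the proof are the images of \<open>w\<close>, and the form is
  the sum of \<open>1\<close> and \<open>1/2\<close> times their squared lengths.
\<close>
lemma idempotent_psd:
  assumes "idempotent jprod c"
  shows "inner (c \<odot> w) w \<ge> 0"
proof -
  define u v where "u = c \<odot> w" and "v = c \<odot> u"
  note sw = jprod_selfadjoint[of c]
  have cu: "2 *\<^sub>R (c \<odot> v) = 3 *\<^sub>R v - u"
    using idempotent_mult_cubic[OF assms, of w] by (simp add: u_def v_def algebra_simps)
  have 1: "inner u u = inner v w" using sw[of w u] by (simp add: u_def v_def inner_commute)
  have "2 * inner v u = inner (2 *\<^sub>R (c \<odot> v)) w" using sw[of v w] by (simp add: u_def)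
  then have 2: "2 * inner v u = 3 * inner v w - inner u w"
    unfolding cu by (simp add: inner_diff_left)
  have "2 * inner v v = inner (2 *\<^sub>R (c \<odot> v)) u" using sw[of v u] by (simp add: v_def)
  then have 3: "2 * inner v v = 3 * inner v u - inner u u"
    unfolding cu by (simp add: inner_diff_left)
  define P1 P2 where "P1 = 2 *\<^sub>R v - u" and "P2 = 4 *\<^sub>R u - 4 *\<^sub>R v"
  have "inner P1 P1 + inner P2 P2 / 2 = 12 * inner v v - 20 * inner v u + 9 * inner u u"
    by (simp add: P1_def P2_def inner_diff_left inner_diff_right inner_commute[of u v] field_simps)
  also have "\<dots> = inner u w"
    using 1 2 3 by (simp add: field_simps)
  finally have "inner u w = inner P1 P1 + inner P2 P2 / 2" ..
  then show ?thesis by (simp add: u_def)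
qed

lemma idempotent_inner_nonneg:
  assumes "idempotent jprod p" "idempotent jprod q"
  shows "inner p q \<ge> 0"
  using idempotent_psd[OF assms(1), of q] assms(2)
  by (simp add: inner_jprod_assoc idempotent_def)

lemma idempotents_orthogonal:
  assumes p: "idempotent jprod p" and q: "idempotent jprod q" and 0: "inner p q = 0"
  shows "p \<odot> q = 0"
proof -
  have "inner (p \<odot> q) q = 0"
    using q 0 by (simp add: inner_jprod_assoc idempotent_def)
  then have "inner (p \<odot> q) (p \<odot> q) = 0"
    by (rule psd_null_direction[OF linear_jprod(1)[of p] subspace_UNIV jprod_selfadjoint
          idempotent_psd[OF p] UNIV_I _ UNIV_I])
  then show ?thesis by simp
qed

text \<open>
  Among the complete orthogonal systems that span \<open>x\<close>, now without the restriction to \<open>jalg x\<close>, a largest one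
  consists of primitive idempotents. If a member \<open>c = f + g\<close> splits, then \<open>f\<close> and \<open>g\<close> annihilate every
  other member \<open>q\<close>: the nonnegative numbers \<open>\<langle>q, f\<rangle>\<close> and \<open>\<langle>q, g\<rangle>\<close> add up to \<open>\<langle>q, c\<rangle> = 0\<close>, and orthogonal
  idempotents have product \<open>0\<close>.
\<close>
lemma spectral_decomposition_exists:
  obtains Q l where "spectral_decomposition jprod e x Q l"
proof -
  define P where "P S \<longleftrightarrow> \<Sum>S = e \<and> (\<exists>l. x = (\<Sum>q\<in>S. l q *\<^sub>R q))" for S
  obtain S0 where "orth_system S0" "P S0"
    unfolding P_def by (rule spectral_idempotents_exist[of x]) blast
  then have "\<exists>S. orth_system S \<and> P S \<and>
    (\<forall>S'. orth_system S' \<and> P S' \<longrightarrow> card S' \<le> card S)"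
    by (rule orth_system_max)
  then obtain S where S: "orth_system S" "P S"
    and max: "\<forall>S'. orth_system S' \<and> P S' \<longrightarrow> card S' \<le> card S"
    by (elim exE conjE) (rule that)
  from S(2) have S1: "\<Sum>S = e" and ex: "\<exists>l. x = (\<Sum>q\<in>S. l q *\<^sub>R q)"
    by (simp_all add: P_def)
  from ex obtain l where l: "x = (\<Sum>q\<in>S. l q *\<^sub>R q)" by (rule exE)
  note fin = orth_system_card(1)[OF S(1)]
  have "primitive_idempotent jprod c" if c: "c \<in> S" for c
  proof (rule ccontr)
    have cid: "idempotent jprod c" "c \<noteq> 0" using S c by (auto simp: orth_system_def)
    assume "\<not> primitive_idempotent jprod c"
    then obtain f g where fg: "idempotent jprod f" "idempotent jprod g" "f \<noteq> 0" "g \<noteq> 0" "c = f + g"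
      using cid by (auto simp: primitive_idempotent_def)
    \<comment> \<open>idempotency of \<open>c = f + g\<close>\<close>
    have "f + g = f + 2 *\<^sub>R (f \<odot> g) + g"
      using cid fg by (simp add: idempotent_def jprod_linear jprod_commute[of g f] scaleR_2 add_ac)
    then have fg0: "f \<odot> g = 0" by simp
    have orth: "q \<odot> f = 0 \<and> q \<odot> g = 0" if q: "q \<in> S" "q \<noteq> c" for q
    proof -
      have qid: "idempotent jprod q" and qc: "q \<odot> c = 0"
        using S c q by (auto simp: orth_system_def)
      have "inner q c = inner q (q \<odot> c)"
        using qid inner_jprod_assoc[of q q c] by (simp add: idempotent_def)
      then have "inner q f + inner q g = 0" using fg(5) qc by (simp add: inner_add_right)
      then have "inner q f = 0" "inner q g = 0"
        using idempotent_inner_nonneg[OF qid fg(1)] idempotent_inner_nonneg[OF qid fg(2)] by linarith+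
      then show ?thesis using idempotents_orthogonal qid fg by blast
    qed
    let ?S' = "insert f (insert g (S - {c}))"
    have split: "orth_system ?S'" "card ?S' = Suc (card S)" "\<Sum>?S' = \<Sum>S"
      using orth_system_split[OF S(1) c fg(5) fg0 fg(1,3,2,4)] orth by blast+
    let ?l' = "\<lambda>q. if q \<in> S - {c} then l q else l c"
    have nf: "f \<notin> S" "g \<notin> S" "f \<noteq> g"
    proof -
      have "f \<noteq> c" "g \<noteq> c" using fg by auto
      then show "f \<notin> S" "g \<notin> S" "f \<noteq> g"
        using orth[of f] orth[of g] fg fg0 by (auto simp: idempotent_def)
    qed
    have "(\<Sum>q\<in>?S'. ?l' q *\<^sub>R q) = l c *\<^sub>R f + (l c *\<^sub>R g + (\<Sum>q\<in>S - {c}. l q *\<^sub>R q))"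
      using nf fin by simp
    also have "\<dots> = l c *\<^sub>R c + (\<Sum>q\<in>S - {c}. l q *\<^sub>R q)"
      using fg by (simp add: scaleR_add_right add_ac)
    also have "\<dots> = x" using l fin c by (simp add: sum.remove)
    finally have "x = (\<Sum>q\<in>?S'. ?l' q *\<^sub>R q)" ..
    then have "\<exists>l. x = (\<Sum>q\<in>?S'. l q *\<^sub>R q)" by (rule exI[where x = ?l'])
    then have "P ?S'" using split(3) S1 by (simp add: P_def)
    then have "card ?S' \<le> card S" using max[THEN spec, of ?S'] split(1) by blast
    then show False using split(2) by linarith
  qed
  then have "jordan_frame jprod e S"
    using S S1 fin by (auto simp: jordan_frame_def orth_system_def)
  then show ?thesis using that l by (auto simp: spectral_decomposition_def)
qed

section \<open>Exponential, trace and eigenvalue bounds\<close>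

lemma jordan_frameD:
  assumes "jordan_frame jprod e Q"
  shows "finite Q" "\<Sum>Q = e" "Q \<noteq> {}"
    and "\<And>q. q \<in> Q \<Longrightarrow> idempotent jprod q" "\<And>q. q \<in> Q \<Longrightarrow> q \<noteq> 0"
    and "\<And>p q. p \<in> Q \<Longrightarrow> q \<in> Q \<Longrightarrow> p \<odot> q = (if p = q then q else 0)"
  using assms unit_nonzero by (auto simp: jordan_frame_def primitive_idempotent_def idempotent_def)

lemma frame_sum_jprod:
  assumes "jordan_frame jprod e Q"
  shows "(\<Sum>q\<in>Q. a q *\<^sub>R q) \<odot> (\<Sum>q\<in>Q. b q *\<^sub>R q) = (\<Sum>q\<in>Q. (a q * b q) *\<^sub>R q)"
proof -
  note Q = jordan_frameD[OF assms]
  have "(\<Sum>q\<in>Q. a q *\<^sub>R q) \<odot> (\<Sum>q\<in>Q. b q *\<^sub>R q) = (\<Sum>p\<in>Q. \<Sum>q\<in>Q. (a q * b p) *\<^sub>R (q \<odot> p))"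
    by (simp add: jprod_sum jprod_linear scaleR_sum_right mult.commute)
  also have "\<dots> = (\<Sum>p\<in>Q. \<Sum>q\<in>Q. if q = p then (a p * b p) *\<^sub>R p else 0)"
    using Q(6) by (intro sum.cong refl) auto
  also have "\<dots> = (\<Sum>p\<in>Q. (a p * b p) *\<^sub>R p)"
    using Q(1) by (simp add: sum.delta)
  finally show ?thesis .
qed

lemma spectral_jpow:
  assumes "spectral_decomposition jprod e x Q l"
  shows "jpow x n = (\<Sum>q\<in>Q. (l q ^ n) *\<^sub>R q)"
proof (induction n)
  case 0
  then show ?case using assms jordan_frameD(2) by (simp add: spectral_decomposition_def)
next
  case (Suc n)
  then show ?case using assms by (simp add: spectral_decomposition_def frame_sum_jprod)
qed

lemma spectral_exp_series:
  assumes "spectral_decomposition jprod e x Q l"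
  shows "(\<lambda>N. \<Sum>n<N. (1 / fact n) *\<^sub>R jpow x n) \<longlonglongrightarrow> (\<Sum>q\<in>Q. exp (l q) *\<^sub>R q)"
proof -
  have "(\<lambda>N. \<Sum>q\<in>Q. (\<Sum>n<N. l q ^ n /\<^sub>R fact n) *\<^sub>R q) \<longlonglongrightarrow> (\<Sum>q\<in>Q. exp (l q) *\<^sub>R q)"
    by (intro tendsto_intros exp_converges[unfolded sums_def])
  moreover have "(\<Sum>q\<in>Q. (\<Sum>n<N. l q ^ n /\<^sub>R fact n) *\<^sub>R q) = (\<Sum>n<N. (1 / fact n) *\<^sub>R jpow x n)" for N
    unfolding spectral_jpow[OF assms] scaleR_sum_left scaleR_sum_right
    by (subst sum.swap) (simp add: divide_inverse mult.commute)
  ultimately show ?thesis by simp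
qed

text \<open>
  The power series does not refer to a decomposition, which makes the choice in the definition of
  the exponential irrelevant.
\<close>
lemma jexp_eq:
  assumes "spectral_decomposition jprod e x Q l"
  shows "jexp jprod e x = (\<Sum>q\<in>Q. exp (l q) *\<^sub>R q)"
proof -
  have "\<exists>Q l. spectral_decomposition jprod e x Q l \<and> jexp jprod e x = (\<Sum>q\<in>Q. exp (l q) *\<^sub>R q)"
    unfolding jexp_def by (rule someI_ex) (use assms in blast)
  then obtain Q' l' where sd: "spectral_decomposition jprod e x Q' l'"
    and eq: "jexp jprod e x = (\<Sum>q\<in>Q'. exp (l' q) *\<^sub>R q)" by (elim exE conjE)
  show ?thesis
    unfolding eq by (rule LIMSEQ_unique[OF spectral_exp_series[OF sd] spectral_exp_series[OF assms]])
qed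

lemma jexp_series: "(\<lambda>N. \<Sum>n<N. (1 / fact n) *\<^sub>R jpow x n) \<longlonglongrightarrow> jexp jprod e x"
proof -
  obtain Q l where sd: "spectral_decomposition jprod e x Q l"
    by (rule spectral_decomposition_exists)
  show ?thesis unfolding jexp_eq[OF sd] by (rule spectral_exp_series[OF sd])
qed

lemma continuous_jpow: "continuous_on UNIV (\<lambda>x. jpow x n)"
proof (induction n)
  case (Suc n)
  have "bounded_bilinear jprod"
    using jprod_bilinear by (simp add: bilinear_conv_bounded_bilinear)
  then show ?case
    using bounded_bilinear.continuous_on[OF _ continuous_on_id Suc] by simp
qed simp

lemma borel_measurable_jexp [measurable]: "jexp jprod e \<in> borel_measurable borel"
proof (rule borel_measurable_LIMSEQ_metric[OF _ jexp_series])
  have "continuous_on UNIV (\<lambda>x. \<Sum>n<N. (1 / fact n) *\<^sub>R jpow x n)" for N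
    by (intro continuous_intros continuous_jpow)
  then show "(\<lambda>x. \<Sum>n<N. (1 / fact n) *\<^sub>R jpow x n) \<in> borel_measurable borel" for N
    by (rule borel_measurable_continuous_onI)
qed

lemma eigenvalues_witness:
  obtains Q l where "spectral_decomposition jprod e x Q l"
    "eigenvalues jprod e x = image_mset l (mset_set Q)"
proof -
  obtain Q l where "spectral_decomposition jprod e x Q l"
    by (rule spectral_decomposition_exists)
  then have "\<exists>M. \<exists>Q l. spectral_decomposition jprod e x Q l \<and> M = image_mset l (mset_set Q)"
    by blast
  then have "\<exists>Q l. spectral_decomposition jprod e x Q l \<and>
      eigenvalues jprod e x = image_mset l (mset_set Q)"
    unfolding eigenvalues_def by (rule someI_ex)
  then show ?thesis by (elim exE conjE) (rule that)
qed

text \<open>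
  The coefficient of \<open>p \<in> Q'\<close> is \<open>\<langle>d, p\<rangle> / \<langle>p, p\<rangle>\<close>. Expanded in the frame \<open>Q\<close>, this is an average of the
  coefficients \<open>l q\<close> with the nonnegative weights \<open>\<langle>q, p\<rangle> / \<langle>p, p\<rangle>\<close>.
\<close>
lemma spectral_bound_unique:
  assumes d: "spectral_decomposition jprod e d Q l" and d': "spectral_decomposition jprod e d Q' l'"
    and B: "\<And>q. q \<in> Q \<Longrightarrow> \<bar>l q\<bar> \<le> B" and p: "p \<in> Q'"
  shows "\<bar>l' p\<bar> \<le> B"
proof -
  have Q: "jordan_frame jprod e Q" "jordan_frame jprod e Q'"
    using d d' by (simp_all add: spectral_decomposition_def)
  note Q1 = jordan_frameD[OF Q(1)] and Q2 = jordan_frameD[OF Q(2)]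
  have 0: "inner q p = 0" if "q \<in> Q'" "q \<noteq> p" for q
    using inner_jprod_assoc[of q p p] Q2(6)[OF that(1) p] Q2(6)[OF p p] that by simp
  have "d = (\<Sum>q\<in>Q'. l' q *\<^sub>R q)"
    using d' by (simp add: spectral_decomposition_def)
  then have "inner d p = (\<Sum>q\<in>Q'. l' q * inner q p)"
    by (simp add: inner_sum_left)
  also have "\<dots> = (\<Sum>q\<in>{p}. l' q * inner q p)"
    using Q2(1) p 0 by (intro sum.mono_neutral_right) auto
  finally have "inner d p = l' p * inner p p" by simp
  moreover have "\<bar>inner d p\<bar> \<le> B * inner p p"
  proof -
    have nn: "inner q p \<ge> 0" if "q \<in> Q" for q
      using idempotent_inner_nonneg Q1(4) Q2(4) p that by blast
    have "\<bar>inner d p\<bar> \<le> (\<Sum>q\<in>Q. \<bar>l q * inner q p\<bar>)"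
      using d by (simp add: spectral_decomposition_def inner_sum_left)
    also have "\<dots> \<le> (\<Sum>q\<in>Q. B * inner q p)"
      using nn B by (intro sum_mono) (simp add: abs_mult mult_right_mono)
    also have "\<dots> = B * inner (\<Sum>Q) p"
      by (simp add: inner_sum_left sum_distrib_left)
    also have "inner (\<Sum>Q) p = inner p p"
      using Q1(2) inner_jprod_assoc[of e p p] Q2(6)[OF p p] by (simp add: jprod_unit)
    finally show ?thesis .
  qed
  ultimately have "\<bar>l' p\<bar> * inner p p \<le> B * inner p p"
    by (simp add: abs_mult)
  then show ?thesis using Q2(5)[OF p] by (simp add: mult_le_cancel_right)
qed

lemma norm_infty_ge:
  assumes "spectral_decomposition jprod e d Q l" "q \<in> Q"
  shows "\<bar>l q\<bar> \<le> norm_infty jprod e d"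
proof -
  obtain Q' l' where w: "spectral_decomposition jprod e d Q' l'"
    "eigenvalues jprod e d = image_mset l' (mset_set Q')" by (rule eigenvalues_witness)
  have "finite Q'" using w jordan_frameD by (auto simp: spectral_decomposition_def)
  then have "\<bar>l' p\<bar> \<le> norm_infty jprod e d" if "p \<in> Q'" for p
    using that by (simp add: norm_infty_def w)
  then show ?thesis using spectral_bound_unique[OF w(1) assms(1)] assms(2) by blast
qed

lemma norm_infty_nonneg: "norm_infty jprod e d \<ge> 0"
proof -
  obtain Q l where sd: "spectral_decomposition jprod e d Q l"
    by (rule spectral_decomposition_exists)
  then obtain q where "q \<in> Q" using jordan_frameD(3) by (auto simp: spectral_decomposition_def)
  then show ?thesis using norm_infty_ge[OF sd, of q] by simp
qed

lemma norm_infty_minus_le: "norm_infty jprod e (- d) \<le> norm_infty jprod e d"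
proof -
  obtain Q l where w: "spectral_decomposition jprod e (- d) Q l"
    "eigenvalues jprod e (- d) = image_mset l (mset_set Q)" by (rule eigenvalues_witness)
  have Q: "finite Q" "Q \<noteq> {}" using w jordan_frameD by (auto simp: spectral_decomposition_def)
  have "- d = (\<Sum>q\<in>Q. l q *\<^sub>R q)" using w by (simp add: spectral_decomposition_def)
  then have "d = - (\<Sum>q\<in>Q. l q *\<^sub>R q)" by (metis minus_minus)
  then have "spectral_decomposition jprod e d Q (\<lambda>q. - l q)"
    using w by (simp add: spectral_decomposition_def sum_negf)
  then have "\<bar>l q\<bar> \<le> norm_infty jprod e d" if "q \<in> Q" for q
    using norm_infty_ge[of d Q "\<lambda>q. - l q" q] that by simp
  then show ?thesis using Q by (simp add: norm_infty_def[of _ _ "- d"] w)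
qed

lemma neighboring_iff:
  "neighboring jprod e \<Delta> A A' \<longleftrightarrow> (\<forall>i. norm_infty jprod e (A i - A' i) \<le> \<Delta>)"
  unfolding neighboring_def by (subst Max_le_iff) auto

text \<open>
  Symmetry is needed because the oracle's guarantee is used in both directions. It is not evident from
  the definition, as the eigenvalues of \<open>d\<close> and \<open>- d\<close> may be read off from different frames.
\<close>
lemma neighboring_sym:
  assumes "neighboring jprod e \<Delta> A A'"
  shows "neighboring jprod e \<Delta> A' A"
  unfolding neighboring_iff
proof
  fix i
  show "norm_infty jprod e (A' i - A i) \<le> \<Delta>"
    using assms norm_infty_minus_le[of "A i - A' i"] unfolding neighboring_iff
    by (simp add: order_trans)
qed

lemma rank_pos: assumes "has_rank jprod e r" shows "r > 0"
proof -
  have "r \<in> card ` {Q. jordan_frame jprod e Q}" using assms by (simp add: has_rank_def)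
  then obtain Q where "jordan_frame jprod e Q" "r = card Q" by auto
  then show ?thesis using jordan_frameD(1,3) by (simp add: card_gt_0_iff)
qed

lemma jtrace_unit:
  assumes "has_rank jprod e r"
  shows "jtrace jprod e e = real r"
proof -
  obtain Q l where w: "spectral_decomposition jprod e e Q l"
    "eigenvalues jprod e e = image_mset l (mset_set Q)" by (rule eigenvalues_witness)
  have fr: "jordan_frame jprod e Q" and e_eq: "e = (\<Sum>q\<in>Q. l q *\<^sub>R q)"
    using w(1) unfolding spectral_decomposition_def by blast+
  note Q = jordan_frameD[OF fr]
  have "l q = 1" if q: "q \<in> Q" for q
  proof -
    have "q = (\<Sum>p\<in>Q. l p *\<^sub>R p) \<odot> q"
      unfolding e_eq[symmetric] by (simp add: jprod_unit)
    also have "\<dots> = (\<Sum>p\<in>Q. l p *\<^sub>R (p \<odot> q))"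
      by (simp add: jprod_sum jprod_linear)
    also have "\<dots> = (\<Sum>p\<in>Q. if p = q then l q *\<^sub>R q else 0)"
      using Q(6) q by (intro sum.cong) auto
    also have "\<dots> = l q *\<^sub>R q" using Q(1) q by (simp add: sum.delta)
    finally have "(1 - l q) *\<^sub>R q = 0" by (simp add: scaleR_diff_left)
    then show ?thesis using Q(5)[OF q] by simp
  qed
  then have "image_mset l (mset_set Q) = image_mset (\<lambda>_. 1) (mset_set Q)"
    using Q(1) by (intro image_mset_cong) simp
  then have "jtrace jprod e e = real (card Q)"
    using Q(1) by (simp add: jtrace_def w(2))
  moreover have "card Q = r" using assms fr by (auto simp: has_rank_def)
  ultimately show ?thesis by simp
qed

context
  fixes \<phi> :: "'a \<Rightarrow> real ^ 'k::finite"
  assumes iso: "isometric_iso jprod e \<phi>"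
begin

lemma iso_linear: "linear \<phi>" "linear (inv \<phi>)" "bij \<phi>"
proof -
  show l: "linear \<phi>" and b: "bij \<phi>" using iso by (simp_all add: isometric_iso_def)
  have inv: "inv \<phi> (\<phi> x) = x" "\<phi> (inv \<phi> y) = y" for x y
    using b by (simp_all add: bij_is_inj bij_is_surj surj_f_inv_f)
  show "linear (inv \<phi>)"
  proof (rule linearI)
    fix v w c
    show "inv \<phi> (v + w) = inv \<phi> v + inv \<phi> w"
      using inv(1)[of "inv \<phi> v + inv \<phi> w"] by (simp add: linear_add[OF l] inv)
    show "inv \<phi> (c *\<^sub>R v) = c *\<^sub>R inv \<phi> v"
      using inv(1)[of "c *\<^sub>R inv \<phi> v"] by (simp add: linear_cmul[OF l] inv)
  qed
qed

lemma jtrace_eq_inner: "jtrace jprod e x = inner (\<phi> e) (\<phi> x)"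
  using iso by (simp add: isometric_iso_def jinner_def jprod_unit)

lemma jtrace_square: "jtrace jprod e (x \<odot> x) = (norm (\<phi> x))\<^sup>2"
proof -
  have "inner (\<phi> x) (\<phi> x) = jtrace jprod e (x \<odot> x)"
    using iso unfolding isometric_iso_def jinner_def by blast
  then show ?thesis by (simp add: power2_norm_eq_inner)
qed

lemma borel_measurable_jtrace: "jtrace jprod e \<in> borel_measurable borel"
proof -
  have "continuous_on UNIV (\<lambda>x. inner (\<phi> e) (\<phi> x))"
    by (intro continuous_intros linear_continuous_on)
       (simp add: iso_linear linear_conv_bounded_linear[symmetric])
  then show ?thesis
    unfolding jtrace_eq_inner[abs_def] by (rule borel_measurable_continuous_onI)
qed

lemma borel_measurable_gibbs: "gibbs jprod e \<eta> \<in> borel_measurable borel"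
proof -
  note [measurable] = borel_measurable_jtrace
  show ?thesis unfolding gibbs_def[abs_def] by measurable
qed

lemma gibbs_in_square_cone: "gibbs jprod e \<eta> s \<in> square_cone jprod"
proof -
  obtain Q l where sd: "spectral_decomposition jprod e (- \<eta> *\<^sub>R s) Q l"
    by (rule spectral_decomposition_exists)
  then have fr: "jordan_frame jprod e Q" by (simp add: spectral_decomposition_def)
  define h where "h = (\<Sum>q\<in>Q. exp (l q / 2) *\<^sub>R q)"
  have hh: "jexp jprod e (- \<eta> *\<^sub>R s) = h \<odot> h"
    unfolding jexp_eq[OF sd] h_def frame_sum_jprod[OF fr] by (simp flip: exp_add)
  define c where "c = sqrt (1 / jtrace jprod e (h \<odot> h))"
  have "gibbs jprod e \<eta> s = (c *\<^sub>R h) \<odot> (c *\<^sub>R h)"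
    unfolding gibbs_def hh c_def by (simp add: jprod_linear jtrace_square flip: power2_eq_square)
  then show ?thesis by (auto simp: square_cone_def)
qed

text \<open>
  The initial iterate is the Gibbs state of loss \<open>0\<close>, so the iterate is the same function of the
  accumulated loss in every round.
\<close>
lemma gibbs_0:
  assumes "has_rank jprod e r"
  shows "gibbs jprod e \<eta> 0 = (1 / real r) *\<^sub>R e"
proof -
  obtain Q l where "spectral_decomposition jprod e 0 Q l"
    by (rule spectral_decomposition_exists)
  then have sd: "spectral_decomposition jprod e 0 Q (\<lambda>_. 0)"
    by (simp add: spectral_decomposition_def)
  have "jexp jprod e 0 = e"
    using jexp_eq[OF sd] sd by (simp add: spectral_decomposition_def jordan_frameD(2))
  then show ?thesis by (simp add: gibbs_def jtrace_unit[OF assms])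
qed

text \<open>
  The idempotents of a frame have nonnegative traces that add up to the trace of \<open>e\<close>, and
  the squared norm of \<open>d\<close> is the sum of its squared eigenvalues weighted by these traces.
\<close>
lemma norm_iso_le_rank_norm_infty:
  assumes "has_rank jprod e r"
  shows "(norm (\<phi> d))\<^sup>2 \<le> real r * (norm_infty jprod e d)\<^sup>2"
proof -
  obtain Q l where sd: "spectral_decomposition jprod e d Q l"
    by (rule spectral_decomposition_exists)
  then have fr: "jordan_frame jprod e Q" by (simp add: spectral_decomposition_def)
  note Q = jordan_frameD[OF fr]
  have tr_sum: "jtrace jprod e (\<Sum>q\<in>Q. a q *\<^sub>R q) = (\<Sum>q\<in>Q. a q * jtrace jprod e q)" for a
    by (simp add: jtrace_eq_inner linear_sum[OF iso_linear(1)] linear_cmul[OF iso_linear(1)]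
        inner_sum_right)
  have nn: "jtrace jprod e q \<ge> 0" if "q \<in> Q" for q
    using jtrace_square[of q] Q(6)[OF that that] by simp
  have sq: "(l q)\<^sup>2 \<le> (norm_infty jprod e d)\<^sup>2" if "q \<in> Q" for q
    using power_mono[OF norm_infty_ge[OF sd that], of 2] by simp
  have "d \<odot> d = (\<Sum>q\<in>Q. (l q)\<^sup>2 *\<^sub>R q)"
    using sd frame_sum_jprod[OF fr] by (simp add: spectral_decomposition_def power2_eq_square)
  then have "(norm (\<phi> d))\<^sup>2 = (\<Sum>q\<in>Q. (l q)\<^sup>2 * jtrace jprod e q)"
    by (simp add: tr_sum flip: jtrace_square)
  also have "\<dots> \<le> (\<Sum>q\<in>Q. (norm_infty jprod e d)\<^sup>2 * jtrace jprod e q)"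
    using nn sq by (intro sum_mono mult_right_mono) auto
  also have "\<dots> = (norm_infty jprod e d)\<^sup>2 * jtrace jprod e (\<Sum>q\<in>Q. 1 *\<^sub>R q)"
    unfolding tr_sum by (simp add: sum_distrib_left)
  also have "\<dots> = real r * (norm_infty jprod e d)\<^sup>2"
    using Q(2) by (simp add: jtrace_unit[OF assms])
  finally show ?thesis .
qed

end
end

section \<open>Renyi bounds\<close>

lemma Holder_integral:
  fixes f w :: "'a \<Rightarrow> real"
  assumes pq: "p > 1" "q > 1" "1 / p + 1 / q = 1"
    and [measurable]: "f \<in> borel_measurable M" "w \<in> borel_measurable M"
    and nn: "\<And>x. x \<in> space M \<Longrightarrow> f x \<ge> 0" "\<And>x. x \<in> space M \<Longrightarrow> w x \<ge> 0"
    and int: "integrable M (\<lambda>x. w x powr p)" "integrable M (\<lambda>x. f x powr q)"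
  shows "(\<integral>x. w x * f x \<partial>M) \<le> (\<integral>x. w x powr p \<partial>M) powr (1 / p) * (\<integral>x. f x powr q \<partial>M) powr (1 / q)"
proof -
  define W F where "W = (\<integral>x. w x powr p \<partial>M)" and "F = (\<integral>x. f x powr q \<partial>M)"
  have "W \<ge> 0" "F \<ge> 0" by (simp_all add: W_def F_def)
  then consider "W = 0" | "F = 0" | "W > 0" "F > 0" by fastforce
  then show ?thesis
  proof cases
    case 1
    then have "AE x in M. w x powr p = 0"
      using integral_nonneg_eq_0_iff_AE[OF int(1)] by (simp add: W_def)
    then have "AE x in M. w x * f x = 0" by eventually_elim simp
    then have "(\<integral>x. w x * f x \<partial>M) = 0" by (rule integral_eq_zero_AE)
    then show ?thesis by simp
  next
    case 2
    then have "AE x in M. f x powr q = 0"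
      using integral_nonneg_eq_0_iff_AE[OF int(2)] by (simp add: F_def)
    then have "AE x in M. w x * f x = 0" by eventually_elim simp
    then have "(\<integral>x. w x * f x \<partial>M) = 0" by (rule integral_eq_zero_AE)
    then show ?thesis by simp
  next
    case 3
    define c d where "c = W powr (1 / p)" and "d = F powr (1 / q)"
    have cd: "c > 0" "d > 0" "c powr p = W" "d powr q = F"
      using 3 pq by (simp_all add: c_def d_def powr_powr)
    have "(\<integral>x. w x * f x \<partial>M) \<le> (\<integral>x. c * d * (w x powr p / (p * W) + f x powr q / (q * F)) \<partial>M)"
    proof (rule integral_mono')
      fix x assume x: "x \<in> space M"
      have "(w x / c) * (f x / d) \<le> (w x / c) powr p / p + (f x / d) powr q / q"
        using pq nn[OF x] cd by (intro Youngs_inequality) auto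
      also have "\<dots> = w x powr p / (p * W) + f x powr q / (q * F)"
        using nn[OF x] cd by (simp add: powr_divide mult.commute)
      finally show "w x * f x \<le> c * d * (w x powr p / (p * W) + f x powr q / (q * F))"
        using cd by (simp add: field_simps)
      show "0 \<le> c * d * (w x powr p / (p * W) + f x powr q / (q * F))"
        using cd 3 pq by (intro mult_nonneg_nonneg add_nonneg_nonneg) auto
    qed (intro integrable_mult_right Bochner_Integration.integrable_add integrable_divide_zero int)
    also have "\<dots> = c * d * (W / (p * W) + F / (q * F))"
      by (simp add: Bochner_Integration.integral_add int W_def F_def)
    also have "\<dots> = c * d" using 3 pq by simp
    finally show ?thesis by (simp add: c_def d_def W_def F_def)
  qed
qed

text \<open>
  With \<open>q = \<alpha> / (\<alpha> - 1)\<close>, the exponent conjugate to \<open>\<alpha>\<close>, this is the dual characterization of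
  \<open>\<parallel>dM/dN\<parallel>\<^sub>\<alpha> \<le> exp ((\<alpha> - 1) * \<rho>)\<close> for the norm of \<open>L\<^sup>\<alpha>(N)\<close>, that is, of Renyi divergence of order \<open>\<alpha>\<close> at most
  \<open>\<alpha> * \<rho>\<close>. The scale is that of concentrated differential privacy, where \<open>\<rho>\<close> is independent of \<open>\<alpha>\<close> for
  Gaussian noise. Test functions with values in \<open>[0,1]\<close> suffice and avoid all questions of integrability.
\<close>
definition renyi_bound :: "real \<Rightarrow> real \<Rightarrow> 'a measure \<Rightarrow> 'a measure \<Rightarrow> bool" where
  "renyi_bound \<alpha> \<rho> M N \<longleftrightarrow>
     (\<forall>f\<in>borel_measurable N. (\<forall>x. 0 \<le> f x \<and> f x \<le> 1) \<longrightarrow>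
        (\<integral>x. f x \<partial>M) \<le> exp ((\<alpha> - 1) * \<rho>) * (\<integral>x. f x powr (\<alpha> / (\<alpha> - 1)) \<partial>N) powr ((\<alpha> - 1) / \<alpha>))"

lemma integrable_unit_interval:
  assumes "prob_space M" "f \<in> borel_measurable M" "\<And>x. 0 \<le> f x \<and> f x \<le> (1::real)"
  shows "integrable M f"
proof -
  interpret prob_space M by fact
  show ?thesis using assms(2,3) by (intro integrable_const_bound[where B = 1]) auto
qed

lemma integral_unit_interval:
  assumes "prob_space M" "f \<in> borel_measurable M" "\<And>x. 0 \<le> f x \<and> f x \<le> (1::real)"
  shows "0 \<le> (\<integral>x. f x \<partial>M)" "(\<integral>x. f x \<partial>M) \<le> 1"
proof -
  interpret prob_space M by fact
  show "0 \<le> (\<integral>x. f x \<partial>M)" using assms(3) by (intro integral_nonneg_AE) auto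
  have "(\<integral>x. f x \<partial>M) \<le> (\<integral>x. 1 \<partial>M)"
    using assms integrable_unit_interval[OF assms] by (intro integral_mono) auto
  then show "(\<integral>x. f x \<partial>M) \<le> 1" by (simp add: prob_space)
qed

lemma powr_unit_interval:
  assumes "0 \<le> x \<and> x \<le> (1::real)" "a \<ge> 0"
  shows "0 \<le> x powr a \<and> x powr a \<le> 1"
  using assms powr_mono2[of a x 1] by simp

lemma renyi_bound_density:
  assumes \<alpha>: "\<alpha> > 1" and N: "prob_space N"
    and w[measurable]: "w \<in> borel_measurable N" and w0: "\<And>x. w x \<ge> 0"
    and dens: "\<And>f. f \<in> borel_measurable N \<Longrightarrow> (\<And>x. 0 \<le> f x \<and> f x \<le> 1) \<Longrightarrow>
        (\<integral>x. f x \<partial>M) = (\<integral>x. w x * f x \<partial>N)"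
    and int: "integrable N (\<lambda>x. w x powr \<alpha>)"
    and bound: "(\<integral>x. w x powr \<alpha> \<partial>N) \<le> exp (\<alpha> * (\<alpha> - 1) * \<rho>)"
  shows "renyi_bound \<alpha> \<rho> M N"
  unfolding renyi_bound_def
proof (intro ballI impI)
  fix f :: "'a \<Rightarrow> real" assume f[measurable]: "f \<in> borel_measurable N" and f01: "\<forall>x. 0 \<le> f x \<and> f x \<le> 1"
  let ?q = "\<alpha> / (\<alpha> - 1)"
  have "(\<integral>x. f x \<partial>M) = (\<integral>x. w x * f x \<partial>N)" using f f01 by (intro dens) auto
  also have "\<dots> \<le> (\<integral>x. w x powr \<alpha> \<partial>N) powr (1 / \<alpha>) * (\<integral>x. f x powr ?q \<partial>N) powr (1 / ?q)"
  proof (rule Holder_integral)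
    show "1 / \<alpha> + 1 / ?q = 1" "?q > 1" using \<alpha> by (simp_all add: field_simps)
    show "integrable N (\<lambda>x. f x powr ?q)"
      using \<alpha> f01 by (intro integrable_unit_interval N powr_unit_interval) auto
  qed (use \<alpha> f01 w0 int in auto)
  also have "\<dots> \<le> exp (\<alpha> * (\<alpha> - 1) * \<rho>) powr (1 / \<alpha>) * (\<integral>x. f x powr ?q \<partial>N) powr (1 / ?q)"
    using bound \<alpha> by (intro mult_right_mono powr_mono2) auto
  also have "exp (\<alpha> * (\<alpha> - 1) * \<rho>) powr (1 / \<alpha>) = exp ((\<alpha> - 1) * \<rho>)"
    using \<alpha> by (simp add: powr_def)
  finally show "(\<integral>x. f x \<partial>M) \<le> exp ((\<alpha> - 1) * \<rho>) * (\<integral>x. f x powr ?q \<partial>N) powr ((\<alpha> - 1) / \<alpha>)"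
    by simp
qed

lemma renyi_bound_refl:
  assumes \<alpha>: "\<alpha> > 1" and N: "prob_space N" and "\<rho> \<ge> 0"
  shows "renyi_bound \<alpha> \<rho> N N"
proof (rule renyi_bound_density[OF \<alpha> N, of "\<lambda>_. 1"])
  interpret prob_space N by fact
  show "integrable N (\<lambda>x. 1 powr \<alpha>)" "(\<integral>x. 1 powr \<alpha> \<partial>N) \<le> exp (\<alpha> * (\<alpha> - 1) * \<rho>)"
    using assms by (simp_all add: prob_space)
qed auto

lemma renyi_bound_mono:
  assumes "renyi_bound \<alpha> \<rho> M N" "\<rho> \<le> \<rho>'" "\<alpha> > 1"
  shows "renyi_bound \<alpha> \<rho>' M N"
  unfolding renyi_bound_def
proof (intro ballI impI)
  fix f :: "'a \<Rightarrow> real" assume f: "f \<in> borel_measurable N" "\<forall>x. 0 \<le> f x \<and> f x \<le> 1"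
  have "(\<integral>x. f x \<partial>M) \<le> exp ((\<alpha> - 1) * \<rho>) * (\<integral>x. f x powr (\<alpha> / (\<alpha> - 1)) \<partial>N) powr ((\<alpha> - 1) / \<alpha>)"
    using assms(1) f by (auto simp: renyi_bound_def)
  also have "\<dots> \<le> exp ((\<alpha> - 1) * \<rho>') * (\<integral>x. f x powr (\<alpha> / (\<alpha> - 1)) \<partial>N) powr ((\<alpha> - 1) / \<alpha>)"
    using assms by (intro mult_right_mono) auto
  finally show "(\<integral>x. f x \<partial>M) \<le> \<dots>" .
qed

lemma renyi_bound_distr:
  assumes "renyi_bound \<alpha> \<rho> M N" and s: "sets M = sets N" and h: "h \<in> N \<rightarrow>\<^sub>M R"
  shows "renyi_bound \<alpha> \<rho> (distr M R h) (distr N R h)"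
  unfolding renyi_bound_def
proof (intro ballI impI)
  note [measurable] = h
  have h'[measurable]: "h \<in> M \<rightarrow>\<^sub>M R" using h s by (simp cong: measurable_cong_sets)
  fix f :: "'b \<Rightarrow> real" assume "f \<in> borel_measurable (distr N R h)" and f: "\<forall>x. 0 \<le> f x \<and> f x \<le> 1"
  then have [measurable]: "f \<in> borel_measurable R" by simp
  have "(\<integral>x. f (h x) \<partial>M) \<le> exp ((\<alpha> - 1) * \<rho>) *
      (\<integral>x. f (h x) powr (\<alpha> / (\<alpha> - 1)) \<partial>N) powr ((\<alpha> - 1) / \<alpha>)"
    using assms(1)[unfolded renyi_bound_def, rule_format, of "\<lambda>x. f (h x)"] f by simp
  then show "(\<integral>x. f x \<partial>distr M R h) \<le> exp ((\<alpha> - 1) * \<rho>) *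
      (\<integral>x. f x powr (\<alpha> / (\<alpha> - 1)) \<partial>distr N R h) powr ((\<alpha> - 1) / \<alpha>)"
    by (simp add: integral_distr)
qed

lemma integral_bind_unit_interval:
  assumes M: "prob_space M" and K: "K \<in> M \<rightarrow>\<^sub>M prob_algebra R"
    and f: "f \<in> borel_measurable R" and f01: "\<And>x. 0 \<le> f x \<and> f x \<le> (1::real)"
  shows "(\<integral>x. f x \<partial>(M \<bind> K)) = (\<integral>x. (\<integral>y. f y \<partial>K x) \<partial>M)"
proof (rule integral_bind[where K = R and B = 1 and B' = 1])
  interpret prob_space M by fact
  show "finite_measure M" by (rule finite_measure_axioms)
  have Kx: "prob_space (K x)" if "x \<in> space M" for x
    using measurable_space[OF K that] by (simp add: space_prob_algebra)
  show "AE x in M. emeasure (K x) (space (K x)) \<le> ennreal 1"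
    using prob_space.emeasure_space_1[OF Kx] by (intro AE_I2) simp
  show "\<bar>f y\<bar> \<le> 1" for y
    using f01[of y] by simp
qed (use K f measurable_prob_algebraD in auto)

text \<open>
  The inner bound replaces the inner integral of \<open>f\<close> by \<open>F\<close>, the \<open>q\<close>-norm of \<open>f\<close> under \<open>L x\<close>. This is again a
  test function with values in \<open>[0,1]\<close>, to which the outer bound applies, and the two \<open>q\<close>-norms combine.
\<close>
lemma renyi_bound_bind:
  assumes \<alpha>: "\<alpha> > 1" and MN: "renyi_bound \<alpha> \<rho> M N" and s: "sets M = sets N"
    and M: "prob_space M" and N: "prob_space N"
    and K: "K \<in> M \<rightarrow>\<^sub>M prob_algebra R" and L: "L \<in> N \<rightarrow>\<^sub>M prob_algebra R"
    and KL: "AE x in M. renyi_bound \<alpha> \<rho>' (K x) (L x)"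
  shows "renyi_bound \<alpha> (\<rho> + \<rho>') (M \<bind> K) (N \<bind> L)"
  unfolding renyi_bound_def
proof (intro ballI impI)
  let ?q = "\<alpha> / (\<alpha> - 1)" and ?i = "(\<alpha> - 1) / \<alpha>"
  have N0: "space N \<noteq> {}" using prob_space.not_empty[OF N] .
  have L': "L \<in> N \<rightarrow>\<^sub>M subprob_algebra R" and K': "K \<in> M \<rightarrow>\<^sub>M subprob_algebra R"
    using K L by (auto intro: measurable_prob_algebraD)
  fix f :: "'b \<Rightarrow> real" assume "f \<in> borel_measurable (N \<bind> L)" and f01: "\<forall>x. 0 \<le> f x \<and> f x \<le> 1"
  then have f[measurable]: "f \<in> borel_measurable R"
    using sets_bind[OF sets_kernel[OF L'] N0] by (simp cong: measurable_cong_sets)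
  \<comment> \<open>clipping makes \<open>F\<close> a test function also outside the space of \<open>N\<close>\<close>
  define F where "F x = min 1 (max 0 (\<integral>y. f y powr ?q \<partial>L x)) powr ?i" for x
  have sp: "space M = space N" using s by (rule sets_eq_imp_space_eq)
  have setsL: "sets (L x) = sets R" and probL: "prob_space (L x)" if "x \<in> space N" for x
    using measurable_space[OF L that] by (auto simp: space_prob_algebra)
  have setsK: "sets (K x) = sets R" and probK: "prob_space (K x)" if "x \<in> space M" for x
    using measurable_space[OF K that] by (auto simp: space_prob_algebra)
  have fq01: "0 \<le> f x powr ?q \<and> f x powr ?q \<le> 1" for x
    using f01 \<alpha> by (intro powr_unit_interval) auto
  have F_eq: "F x = (\<integral>y. f y powr ?q \<partial>L x) powr ?i"
    and Fq: "F x powr ?q = (\<integral>y. f y powr ?q \<partial>L x)" if x: "x \<in> space N" for x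
  proof -
    have "(\<lambda>y. f y powr ?q) \<in> borel_measurable (L x)"
      using setsL[OF x] by (simp cong: measurable_cong_sets)
    note b = integral_unit_interval[OF probL[OF x] this fq01]
    then show "F x = (\<integral>y. f y powr ?q \<partial>L x) powr ?i" by (simp add: F_def)
    then show "F x powr ?q = (\<integral>y. f y powr ?q \<partial>L x)" using b \<alpha> by (simp add: powr_powr)
  qed
  have F01: "0 \<le> F x \<and> F x \<le> 1" for x
    unfolding F_def using \<alpha> by (intro powr_unit_interval) auto
  have intm: "(\<lambda>x. \<integral>y. g y \<partial>J x) \<in> borel_measurable P"
    if "g \<in> borel_measurable R" "J \<in> P \<rightarrow>\<^sub>M subprob_algebra R" for g :: "'b \<Rightarrow> real" and J P
    using measurable_compose[OF that(2) integral_measurable_subprob_algebra[OF that(1)]] .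
  have [measurable]: "(\<lambda>x. \<integral>y. f y powr ?q \<partial>L x) \<in> borel_measurable N"
    by (intro intm L') measurable
  have Fm[measurable]: "F \<in> borel_measurable N" unfolding F_def by measurable
  then have FmM[measurable]: "F \<in> borel_measurable M" using s by (simp cong: measurable_cong_sets)
  have "(\<integral>x. f x \<partial>(M \<bind> K)) = (\<integral>x. (\<integral>y. f y \<partial>K x) \<partial>M)"
    using f01 by (intro integral_bind_unit_interval[OF M K f]) auto
  also have "\<dots> \<le> (\<integral>x. exp ((\<alpha> - 1) * \<rho>') * F x \<partial>M)"
  proof (rule integral_mono_AE')
    show "integrable M (\<lambda>x. exp ((\<alpha> - 1) * \<rho>') * F x)"
      using F01 by (intro integrable_mult_right integrable_unit_interval[OF M]) auto
    show "AE x in M. (\<integral>y. f y \<partial>K x) \<le> exp ((\<alpha> - 1) * \<rho>') * F x"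
      using KL AE_space
    proof eventually_elim
      fix x assume r: "renyi_bound \<alpha> \<rho>' (K x) (L x)" and "x \<in> space M"
      then have x: "x \<in> space N" by (simp add: sp)
      then have "f \<in> borel_measurable (L x)" using f setsL by (simp cong: measurable_cong_sets)
      then show "(\<integral>y. f y \<partial>K x) \<le> exp ((\<alpha> - 1) * \<rho>') * F x"
        using r f01 unfolding F_eq[OF x] renyi_bound_def by blast
    qed
    show "AE x in M. 0 \<le> exp ((\<alpha> - 1) * \<rho>') * F x" using F01 by simp
  qed
  also have "\<dots> = exp ((\<alpha> - 1) * \<rho>') * (\<integral>x. F x \<partial>M)" by simp
  also have "(\<integral>x. F x \<partial>M) \<le> exp ((\<alpha> - 1) * \<rho>) * (\<integral>x. F x powr ?q \<partial>N) powr ?i"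
    using MN F01 Fm unfolding renyi_bound_def by blast
  also have "(\<integral>x. F x powr ?q \<partial>N) = (\<integral>x. (\<integral>y. f y powr ?q \<partial>L x) \<partial>N)"
    using Fq by (intro Bochner_Integration.integral_cong) auto
  also have "\<dots> = (\<integral>x. f x powr ?q \<partial>(N \<bind> L))"
    using fq01 by (intro integral_bind_unit_interval[OF N L, symmetric]) auto
  finally show "(\<integral>x. f x \<partial>(M \<bind> K)) \<le> exp ((\<alpha> - 1) * (\<rho> + \<rho>')) * (\<integral>x. f x powr ?q \<partial>(N \<bind> L)) powr ?i"
    by (simp add: distrib_left exp_add mult_ac)
qed

text \<open>
  For an indicator function the bound reads \<open>M S \<le> exp ((\<alpha> - 1) * \<rho>) * (N S) powr ((\<alpha> - 1) / \<alpha>)\<close>. The factor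
  \<open>exp \<epsilon>\<close> is moved to \<open>N S\<close> before Young's inequality separates the product.
\<close>
lemma renyi_bound_imp_dp:
  assumes \<alpha>: "\<alpha> > 1" and r: "renyi_bound \<alpha> \<rho> M N" and N: "prob_space N"
    and s: "sets M = sets N" and S: "S \<in> sets N"
    and \<delta>: "exp ((\<alpha> - 1) * (\<alpha> * \<rho> - \<epsilon>)) \<le> \<delta>"
  shows "measure M S \<le> exp \<epsilon> * measure N S + \<delta>"
proof -
  let ?q = "\<alpha> / (\<alpha> - 1)" and ?i = "(\<alpha> - 1) / \<alpha>"
  let ?v = "measure N S"
  have S': "S \<in> sets M" using S s by simp
  have "indicator S x powr ?q = (indicator S x :: real)" for x by (simp add: indicator_def)
  then have "measure M S \<le> exp ((\<alpha> - 1) * \<rho>) * ?v powr ?i"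
    using r[unfolded renyi_bound_def, rule_format, of "indicator S"] S S'
    by simp
  also have "\<dots> = exp ((\<alpha> - 1) * (\<alpha> * \<rho> - \<epsilon>) / \<alpha>) * (exp \<epsilon> * ?v) powr ?i"
  proof -
    have "(exp \<epsilon> * ?v) powr ?i = exp (?i * \<epsilon>) * ?v powr ?i"
      by (subst powr_mult) (auto simp: powr_def)
    moreover have "(\<alpha> - 1) * \<rho> = (\<alpha> - 1) * (\<alpha> * \<rho> - \<epsilon>) / \<alpha> + ?i * \<epsilon>"
      using \<alpha> by (simp add: field_simps)
    ultimately show ?thesis by (simp add: exp_add)
  qed
  also have "\<dots> \<le> exp ((\<alpha> - 1) * (\<alpha> * \<rho> - \<epsilon>) / \<alpha>) powr \<alpha> / \<alpha> + ((exp \<epsilon> * ?v) powr ?i) powr ?q / ?q"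
    using \<alpha> by (intro Youngs_inequality) (simp_all add: field_simps)
  also have "\<dots> = exp ((\<alpha> - 1) * (\<alpha> * \<rho> - \<epsilon>)) / \<alpha> + ?i * (exp \<epsilon> * ?v)"
    using \<alpha> by (simp add: powr_powr) (simp add: powr_def)
  also have "\<dots> \<le> exp ((\<alpha> - 1) * (\<alpha> * \<rho> - \<epsilon>)) + exp \<epsilon> * ?v"
    using \<alpha> by (intro add_mono mult_left_le_one_le) (auto simp: field_simps)
  finally show ?thesis using \<delta> by simp
qed

lemma pmf_hoeffding:
  fixes P :: "'m::finite pmf" and Z :: "'m \<Rightarrow> real"
  assumes Z: "\<And>i. i \<in> set_pmf P \<Longrightarrow> \<bar>Z i\<bar> \<le> B" and l: "l > 0"
  shows "measure_pmf.expectation P (\<lambda>i. exp (l * Z i)) \<le>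
    exp (l * measure_pmf.expectation P Z + l\<^sup>2 * B\<^sup>2 / 2)"
proof -
  interpret interval_bounded_random_variable "measure_pmf P" Z "-B" B
    by unfold_locales (use Z in \<open>auto simp: AE_measure_pmf_iff abs_le_iff minus_le_iff\<close>)
  define m where "m = measure_pmf.expectation P Z"
  have "ennreal (measure_pmf.expectation P (\<lambda>i. exp (l * (Z i - m)))) =
     (\<integral>\<^sup>+ i. exp (l * (Z i - m)) \<partial>measure_pmf P)"
    by (intro nn_integral_eq_integral[symmetric] integrable_measure_pmf_finite) auto
  also have "\<dots> \<le> ennreal (exp (l\<^sup>2 * (B - - B)\<^sup>2 / 8))"
    unfolding m_def by (rule Hoeffdings_lemma_nn_integral[OF l])
  also have "l\<^sup>2 * (B - - B)\<^sup>2 / 8 = l\<^sup>2 * B\<^sup>2 / 2" by (simp add: power2_eq_square field_simps)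
  finally have "measure_pmf.expectation P (\<lambda>i. exp (l * (Z i - m))) \<le> exp (l\<^sup>2 * B\<^sup>2 / 2)" by simp
  also have "(\<lambda>i. exp (l * (Z i - m))) = (\<lambda>i. exp (l * Z i) * exp (- (l * m)))"
    by (simp add: right_diff_distrib exp_diff exp_minus divide_inverse)
  finally have "measure_pmf.expectation P (\<lambda>i. exp (l * Z i)) * exp (- (l * m)) \<le> exp (l\<^sup>2 * B\<^sup>2 / 2)"
    by (simp only: integral_mult_left_zero)
  then have "measure_pmf.expectation P (\<lambda>i. exp (l * Z i)) * exp (- (l * m)) * exp (l * m) \<le>
    exp (l\<^sup>2 * B\<^sup>2 / 2) * exp (l * m)"
    by (rule mult_right_mono) simp
  then show ?thesis
    by (simp add: m_def[symmetric] mult.assoc add.commute[of "l * m"] flip: exp_add)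
qed

text \<open>
  Let \<open>Z\<close> be the log-likelihood ratio, which lies in \<open>[-B, B]\<close>. Since \<open>exp (- Z)\<close> has mean \<open>1\<close> under \<open>P\<close>,
  Hoeffding's lemma for \<open>- Z\<close> bounds the mean of \<open>Z\<close>, the Kullback-Leibler divergence, by \<open>B\<^sup>2 / 2\<close>. Hoeffding's
  lemma for \<open>(\<alpha> - 1) * Z\<close> then bounds the moment of order \<open>\<alpha>\<close> of the likelihood ratio.
\<close>
lemma renyi_bound_pure_dp:
  fixes P Q :: "'m::finite pmf"
  assumes \<alpha>: "\<alpha> > 1" and PQ: "\<And>i. pmf P i \<le> exp B * pmf Q i" and QP: "\<And>i. pmf Q i \<le> exp B * pmf P i"
  shows "renyi_bound \<alpha> (B\<^sup>2 / 2) (measure_pmf P) (measure_pmf Q)"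
proof -
  have supp: "pmf P i = 0 \<longleftrightarrow> pmf Q i = 0" for i
    using PQ[of i] QP[of i] pmf_nonneg[of P i] pmf_nonneg[of Q i] by fastforce
  define w where "w i = pmf P i / pmf Q i" for i
  define Z where "Z i = ln (w i)" for i
  have pos: "pmf P i > 0" "pmf Q i > 0" "w i > 0" if "i \<in> set_pmf P" for i
    using that supp[of i] by (auto simp: set_pmf_iff w_def pmf_positive_iff pmf_nonneg order_less_le)
  have expZ: "exp (a * Z i) = w i powr a" if "i \<in> set_pmf P" for a i
    using pos[OF that] by (simp add: Z_def powr_def)
  have ZB: "\<bar>Z i\<bar> \<le> B" if "i \<in> set_pmf P" for i
  proof -
    have "w i \<le> exp B" "1 / w i \<le> exp B"
      using PQ[of i] QP[of i] pos[OF that] by (simp_all add: w_def field_simps)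
    then have "ln (w i) \<le> B" "ln (1 / w i) \<le> B"
      using pos(3)[OF that] by (metis ln_exp ln_le_cancel_iff exp_gt_zero zero_less_divide_1_iff)+
    then show ?thesis using pos(3)[OF that] by (simp add: Z_def ln_div abs_le_iff)
  qed
  let ?E = "measure_pmf.expectation P"
  have EP: "?E f = (\<Sum>i\<in>UNIV. f i * pmf P i)" for f :: "'m \<Rightarrow> real"
    by (rule integral_measure_pmf_real) auto
  have EQ: "measure_pmf.expectation Q f = (\<Sum>i\<in>UNIV. f i * pmf Q i)" for f :: "'m \<Rightarrow> real"
    by (rule integral_measure_pmf_real) auto
  have wQ: "w i * pmf Q i = pmf P i" for i using supp[of i] by (auto simp: w_def)
  have "?E (\<lambda>i. exp (1 * - Z i)) = 1"
  proof -
    have "exp (- Z i) * pmf P i = pmf Q i" for i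
    proof (cases "i \<in> set_pmf P")
      case True
      then show ?thesis using expZ[OF True, of "-1"] pos[OF True]
        by (simp add: powr_minus w_def)
    next
      case False
      then show ?thesis using supp[of i] by (simp add: set_pmf_iff)
    qed
    then show ?thesis by (simp add: EP sum_pmf_eq_1)
  qed
  moreover have "?E (\<lambda>i. exp (1 * - Z i)) \<le> exp (1 * ?E (\<lambda>i. - Z i) + 1\<^sup>2 * B\<^sup>2 / 2)"
    using ZB by (intro pmf_hoeffding) auto
  ultimately have EZ: "?E Z \<le> B\<^sup>2 / 2" by simp
  have "measure_pmf.expectation Q (\<lambda>i. w i powr \<alpha>) = ?E (\<lambda>i. exp ((\<alpha> - 1) * Z i))"
  proof -
    have "w i powr \<alpha> * pmf Q i = exp ((\<alpha> - 1) * Z i) * pmf P i" for i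
    proof (cases "i \<in> set_pmf P")
      case True
      have "w i powr \<alpha> = w i powr (\<alpha> - 1) * w i"
        using pos[OF True] powr_add[of "w i" "\<alpha> - 1" 1] by simp
      then show ?thesis using wQ[of i] expZ[OF True] by (simp add: mult.assoc)
    next
      case False
      then show ?thesis using supp[of i] by (simp add: set_pmf_iff)
    qed
    then show ?thesis by (simp add: EP EQ)
  qed
  also have "\<dots> \<le> exp ((\<alpha> - 1) * ?E Z + (\<alpha> - 1)\<^sup>2 * B\<^sup>2 / 2)"
    using ZB \<alpha> by (intro pmf_hoeffding) auto
  also have "\<dots> \<le> exp (\<alpha> * (\<alpha> - 1) * (B\<^sup>2 / 2))"
  proof -
    have "(\<alpha> - 1) * ?E Z \<le> (\<alpha> - 1) * (B\<^sup>2 / 2)" using EZ \<alpha> by (intro mult_left_mono) auto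
    moreover have "(\<alpha> - 1) * (B\<^sup>2 / 2) + (\<alpha> - 1)\<^sup>2 * B\<^sup>2 / 2 = \<alpha> * (\<alpha> - 1) * (B\<^sup>2 / 2)"
      by (simp add: power2_eq_square field_simps)
    ultimately show ?thesis by simp
  qed
  finally have bound: "measure_pmf.expectation Q (\<lambda>i. w i powr \<alpha>) \<le> exp (\<alpha> * (\<alpha> - 1) * (B\<^sup>2 / 2))" .
  show ?thesis
  proof (rule renyi_bound_density[OF \<alpha> _ _ _ _ _ bound])
    show "prob_space (measure_pmf Q)" by (rule measure_pmf.prob_space_axioms)
    show "(\<integral>x. f x \<partial>measure_pmf P) = (\<integral>x. w x * f x \<partial>measure_pmf Q)" for f
      unfolding EP EQ using wQ by (simp add: mult_ac)
  qed (auto simp: w_def intro: integrable_measure_pmf_finite)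
qed

section \<open>Gaussian noise\<close>

definition gaussian_pdf :: "real \<Rightarrow> real ^ 'k::finite \<Rightarrow> real" where
  "gaussian_pdf \<sigma> v = (1 / sqrt (2 * pi * \<sigma>\<^sup>2)) ^ CARD('k) * exp (- (norm v)\<^sup>2 / (2 * \<sigma>\<^sup>2))"

lemma gaussian_pdf_prod: "gaussian_pdf \<sigma> v = (\<Prod>i\<in>UNIV. normal_density 0 \<sigma> (v $ i))"
proof -
  have "(norm v)\<^sup>2 = (\<Sum>i\<in>UNIV. (v $ i)\<^sup>2)"
    unfolding power2_norm_eq_inner by (simp add: inner_vec_def power2_eq_square)
  then have "exp (- (norm v)\<^sup>2 / (2 * \<sigma>\<^sup>2)) = (\<Prod>i\<in>UNIV. exp (- (v $ i)\<^sup>2 / (2 * \<sigma>\<^sup>2)))"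
    by (simp add: sum_negf sum_divide_distrib flip: exp_sum)
  then show ?thesis
    by (simp add: gaussian_pdf_def normal_density_def prod.distrib prod_dividef power_divide)
qed

lemma gaussian_pdf_pos: "\<sigma> > 0 \<Longrightarrow> gaussian_pdf \<sigma> v > 0"
  by (simp add: gaussian_pdf_def)

lemma borel_measurable_gaussian_pdf [measurable]: "gaussian_pdf \<sigma> \<in> borel_measurable borel"
  unfolding gaussian_pdf_def[abs_def] by measurable

lemma gaussian_eq_density: "gaussian \<sigma> = density lborel (gaussian_pdf \<sigma>)"
  by (simp add: gaussian_def gaussian_pdf_prod)

lemma nn_integral_gaussian_pdf:
  assumes "\<sigma> > 0"
  shows "(\<integral>\<^sup>+v. gaussian_pdf \<sigma> (v :: real ^ 'k::finite) \<partial>lborel) = 1"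
proof -
  have "gaussian_pdf \<sigma> v = (\<Prod>b\<in>Basis. normal_density 0 \<sigma> (v \<bullet> b))" for v :: "real ^ 'k"
  proof -
    have "(\<Prod>b\<in>Basis. normal_density 0 \<sigma> (v \<bullet> b)) = (\<Prod>i\<in>UNIV. normal_density 0 \<sigma> (v \<bullet> axis i 1))"
      by (rule prod.reindex_cong[of "\<lambda>i. axis i 1"]) (auto simp: Basis_vec_def inj_on_def axis_eq_axis)
    then show ?thesis by (simp add: gaussian_pdf_prod inner_axis)
  qed
  then have "(\<integral>\<^sup>+v. gaussian_pdf \<sigma> (v :: real ^ 'k) \<partial>lborel) =
    (\<integral>\<^sup>+v. (\<Prod>b\<in>(Basis :: (real ^ 'k) set). ennreal (normal_density 0 \<sigma> (v \<bullet> b))) \<partial>lborel)"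
    by (simp add: prod_ennreal)
  also have "\<dots> = (\<Prod>b\<in>(Basis :: (real ^ 'k) set). (\<integral>\<^sup>+x. ennreal (normal_density 0 \<sigma> x) \<partial>lborel))"
    by (intro nn_integral_lborel_prod) auto
  also have "(\<integral>\<^sup>+x. ennreal (normal_density 0 \<sigma> x) \<partial>lborel) = 1"
    using prob_space.emeasure_space_1[OF prob_space_normal_density[OF assms, of 0]]
    by (simp add: emeasure_density)
  finally show ?thesis by simp
qed

lemma prob_space_gaussian:
  assumes "\<sigma> > 0"
  shows "prob_space (gaussian \<sigma>)"
  by (rule prob_spaceI) (simp add: gaussian_eq_density emeasure_density nn_integral_gaussian_pdf assms)

lemma sets_gaussian [measurable_cong, simp]: "sets (gaussian \<sigma>) = sets borel"
  by (simp add: gaussian_eq_density)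

lemma shifted_gaussian:
  "distr (gaussian \<sigma>) borel ((+) a) = density lborel (\<lambda>v. gaussian_pdf \<sigma> (v - a))"
proof -
  have "density (distr lborel borel ((+) a)) (\<lambda>v. ennreal (gaussian_pdf \<sigma> (v - a))) =
    distr (density lborel (\<lambda>v. ennreal (gaussian_pdf \<sigma> (a + v - a)))) borel ((+) a)"
    by (rule density_distr) measurable
  then show ?thesis by (simp add: lborel_distr_plus gaussian_eq_density)
qed

text \<open>
  Completing the square: the integrand of the moment of order \<open>\<alpha>\<close> is itself a multiple of a Gaussian
  density, with the mean moved along the line through \<open>a'\<close> and \<open>a\<close>.
\<close>
lemma gaussian_pdf_ratio_powr:
  fixes v a a' :: "real ^ 'k::finite"
  assumes "\<sigma> > 0"
  shows "gaussian_pdf \<sigma> (v - a') * (gaussian_pdf \<sigma> (v - a) / gaussian_pdf \<sigma> (v - a')) powr \<alpha> =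
     exp (\<alpha> * (\<alpha> - 1) * ((norm (a - a'))\<^sup>2 / (2 * \<sigma>\<^sup>2))) *
     gaussian_pdf \<sigma> (v - (a' + \<alpha> *\<^sub>R (a - a')))"
proof -
  define u d where "u = v - a'" and "d = a - a'"
  have eqs: "v - a = u - d" "v - (a' + \<alpha> *\<^sub>R (a - a')) = u - \<alpha> *\<^sub>R d"
    by (simp_all add: u_def d_def)
  have ud: "(norm (u - s *\<^sub>R d))\<^sup>2 = (norm u)\<^sup>2 - 2 * s * inner u d + s\<^sup>2 * (norm d)\<^sup>2" for s
    unfolding power2_norm_eq_inner
    by (simp add: inner_diff_left inner_diff_right inner_commute[of d u] power2_eq_square algebra_simps)
  define C where "C = (1 / sqrt (2 * pi * \<sigma>\<^sup>2)) ^ CARD('k)"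
  have C: "C > 0" using assms by (simp add: C_def)
  have "gaussian_pdf \<sigma> (u - d) / gaussian_pdf \<sigma> u = exp ((2 * inner u d - (norm d)\<^sup>2) / (2 * \<sigma>\<^sup>2))"
    using C ud[of 1] unfolding gaussian_pdf_def C_def[symmetric]
    by (simp add: diff_divide_distrib add_divide_distrib flip: exp_diff)
  then have "gaussian_pdf \<sigma> u * (gaussian_pdf \<sigma> (u - d) / gaussian_pdf \<sigma> u) powr \<alpha> =
    C * exp (- (norm u)\<^sup>2 / (2 * \<sigma>\<^sup>2) + \<alpha> * ((2 * inner u d - (norm d)\<^sup>2) / (2 * \<sigma>\<^sup>2)))"
    unfolding gaussian_pdf_def C_def[symmetric] exp_add by (simp add: powr_def)
  also have "- (norm u)\<^sup>2 / (2 * \<sigma>\<^sup>2) + \<alpha> * ((2 * inner u d - (norm d)\<^sup>2) / (2 * \<sigma>\<^sup>2)) =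
    \<alpha> * (\<alpha> - 1) * ((norm d)\<^sup>2 / (2 * \<sigma>\<^sup>2)) + - (norm (u - \<alpha> *\<^sub>R d))\<^sup>2 / (2 * \<sigma>\<^sup>2)"
    using assms unfolding ud by (simp add: field_simps power2_eq_square)
  finally show ?thesis
    unfolding eqs
    unfolding u_def[symmetric] d_def[symmetric]
    unfolding gaussian_pdf_def C_def[symmetric] exp_add by simp
qed

lemma renyi_bound_gaussian:
  fixes a a' :: "real ^ 'k::finite"
  assumes \<sigma>: "\<sigma> > 0" and \<alpha>: "\<alpha> > 1"
  shows "renyi_bound \<alpha> ((norm (a - a'))\<^sup>2 / (2 * \<sigma>\<^sup>2))
    (distr (gaussian \<sigma>) borel ((+) a)) (distr (gaussian \<sigma>) borel ((+) a'))"
proof -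
  let ?g = "\<lambda>b v. gaussian_pdf \<sigma> (v - b)"
  let ?w = "\<lambda>v. ?g a v / ?g a' v"
  let ?c = "exp (\<alpha> * (\<alpha> - 1) * ((norm (a - a'))\<^sup>2 / (2 * \<sigma>\<^sup>2)))"
  note pos = gaussian_pdf_pos[OF \<sigma>]
  have prob: "prob_space (density lborel (?g b))" for b
    unfolding shifted_gaussian[symmetric]
    by (intro prob_space.prob_space_distr prob_space_gaussian \<sigma>) measurable
  have int: "integrable lborel (?g b)" "(\<integral>v. ?g b v \<partial>lborel) = 1" for b
  proof -
    have "(\<integral>\<^sup>+v. ?g b v \<partial>lborel) = ennreal 1"
      using prob_space.emeasure_space_1[OF prob[of b]] by (simp add: emeasure_density)
    then have "has_bochner_integral lborel (?g b) 1"
      using less_imp_le[OF pos] by (intro has_bochner_integral_nn_integral) auto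
    then show "integrable lborel (?g b)" "(\<integral>v. ?g b v \<partial>lborel) = 1"
      by (auto simp: has_bochner_integral_iff)
  qed
  have dens: "integral\<^sup>L (density lborel (?g b)) f = (\<integral>v. ?g b v * f v \<partial>lborel)"
    if "f \<in> borel_measurable borel" for f b
    using that less_imp_le[OF pos] by (subst integral_density) auto
  have ratio: "?g a' v * ?w v powr \<alpha> = ?c * ?g (a' + \<alpha> *\<^sub>R (a - a')) v" for v
    by (rule gaussian_pdf_ratio_powr[OF \<sigma>])
  show ?thesis
    unfolding shifted_gaussian
  proof (rule renyi_bound_density[OF \<alpha> prob, where w = ?w])
    show "?w \<in> borel_measurable (density lborel (?g a'))" by measurable
    show "0 \<le> ?w v" for v using pos less_imp_le by (metis divide_nonneg_pos)
    show "(\<integral>v. f v \<partial>density lborel (?g a)) = (\<integral>v. ?w v * f v \<partial>density lborel (?g a'))"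
      if "f \<in> borel_measurable (density lborel (?g a'))" for f
    proof -
      have [measurable]: "f \<in> borel_measurable borel" using that by simp
      have "?g a' v * (?w v * f v) = ?g a v * f v" for v
        using pos[of "v - a'"] by simp
      then show ?thesis by (simp add: dens)
    qed
    have "integrable lborel (\<lambda>v. ?g a' v *\<^sub>R ?w v powr \<alpha>)"
      unfolding real_scaleR_def ratio by (intro integrable_mult_right int)
    then show "integrable (density lborel (?g a')) (\<lambda>v. ?w v powr \<alpha>)"
      using less_imp_le[OF pos] by (subst integrable_density) auto
    have "(\<integral>v. ?w v powr \<alpha> \<partial>density lborel (?g a')) = ?c"
      by (subst dens) (simp_all add: ratio int)
    then show "(\<integral>v. ?w v powr \<alpha> \<partial>density lborel (?g a')) \<le> ?c" by simp
  qed
qed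

section \<open>Privacy of the multiplicative weights algorithm\<close>

lemma measurable_pmf_kernel:
  fixes P :: "'a \<Rightarrow> 'm::finite pmf"
  assumes "\<And>i. (\<lambda>x. pmf (P x) i) \<in> borel_measurable M"
  shows "(\<lambda>x. measure_pmf (P x)) \<in> M \<rightarrow>\<^sub>M prob_algebra (count_space UNIV)"
proof (intro measurable_prob_algebraI measurable_subprob_algebra)
  show "(\<lambda>x. emeasure (measure_pmf (P x)) X) \<in> borel_measurable M" for X
    using assms by (simp add: emeasure_measure_pmf_finite)
qed (auto intro: measure_pmf.prob_space_axioms prob_space_imp_subprob_space)

lemma measurable_state [measurable]:
  "(fst :: 'a::euclidean_space \<times> 'a \<times> 'a \<Rightarrow> 'a) \<in> borel_measurable borel"
  "(snd :: 'a \<times> 'a \<times> 'a \<Rightarrow> 'a \<times> 'a) \<in> borel_measurable borel"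
  "(fst :: 'a \<times> 'a \<Rightarrow> 'a) \<in> borel_measurable borel"
  "(snd :: 'a \<times> 'a \<Rightarrow> 'a) \<in> borel_measurable borel"
  by (intro borel_measurable_continuous_onI continuous_intros)+

context euclidean_jordan_algebra
begin

context
  fixes \<phi> :: "'a \<Rightarrow> real ^ 'k::finite"
    and Orc :: "('m::finite \<Rightarrow> 'a) \<Rightarrow> ('m \<Rightarrow> real) \<Rightarrow> 'a \<Rightarrow> 'm pmf"
    and r :: nat and \<eta> \<sigma> :: real and b :: "'m \<Rightarrow> real"
  assumes iso: "isometric_iso jprod e \<phi>" and rank: "has_rank jprod e r" and \<sigma>: "\<sigma> > 0"
begin

abbreviation "mround \<equiv> mwu_round jprod e \<phi> Orc \<eta> \<sigma> b"
abbreviation "mstate \<equiv> mwu_state jprod e \<phi> Orc r \<eta> \<sigma> b"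

text \<open>
  The effect of one round as a function of the noisy loss \<open>y\<close>, before it is halved; all randomness of the
  round is in \<open>y\<close>.
\<close>
definition next_state :: "'a \<times> 'a \<times> 'a \<Rightarrow> 'a \<Rightarrow> 'a \<times> 'a \<times> 'a" where
  "next_state st y = (fst st + (1 / 2) *\<^sub>R y, fst (snd st) + snd (snd st),
     gibbs jprod e \<eta> (fst st + (1 / 2) *\<^sub>R y))"

text \<open>
  The coordinates of the loss \<open>a\<close> with the noise added. Working in coordinates makes a round the
  post-processing of a shifted Gaussian.
\<close>
definition noisy_loss :: "'a \<Rightarrow> (real ^ 'k) measure" where
  "noisy_loss a = distr (gaussian \<sigma>) borel ((+) (\<phi> a))"

lemma measurable_inv_iso [measurable]: "inv \<phi> \<in> borel_measurable borel"
  using iso_linear(2)[OF iso]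
  by (intro borel_measurable_continuous_onI linear_continuous_on) (simp add: linear_conv_bounded_linear)

lemmas measurable_gibbs [measurable] = borel_measurable_gibbs[OF iso]

lemma measurable_next_state [measurable]:
  assumes [measurable]: "f \<in> M \<rightarrow>\<^sub>M borel" "g \<in> M \<rightarrow>\<^sub>M borel"
  shows "(\<lambda>x. next_state (f x) (g x)) \<in> M \<rightarrow>\<^sub>M borel"
  unfolding next_state_def by (intro borel_measurable_Pair) measurable

lemma gaussian_prob_algebra [measurable]: "gaussian \<sigma> \<in> space (prob_algebra borel)"
  using prob_space_gaussian[OF \<sigma>] by (simp add: space_prob_algebra)

lemma mwu_round_alt:
  "mround A st = measure_pmf (Orc A b (snd (snd st))) \<bind> (\<lambda>p. gaussian \<sigma> \<bind>
     (\<lambda>\<nu>. return borel (next_state st (A p + inv \<phi> \<nu>))))"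
  by (cases st) (simp add: mwu_round_def next_state_def Let_def)

lemma measurable_mwu_round:
  assumes "\<And>i. (\<lambda>x. pmf (Orc A b x) i) \<in> borel_measurable borel"
  shows "mround A \<in> borel \<rightarrow>\<^sub>M prob_algebra borel"
proof -
  have [measurable]: "(\<lambda>st. measure_pmf (Orc A b (snd (snd st)))) \<in> (borel :: ('a \<times> 'a \<times> 'a) measure) \<rightarrow>\<^sub>M prob_algebra (count_space UNIV)"
    by (rule measurable_compose[OF _ measurable_pmf_kernel[OF assms]]) measurable
  show ?thesis
    unfolding mwu_round_alt[abs_def] by measurable
qed

lemma inv_iso_add: "inv \<phi> (\<phi> a + v) = a + inv \<phi> v"
  using iso_linear[OF iso] by (simp add: linear_add bij_is_inj)

lemma mwu_round_distr:
  "mround A st = measure_pmf (Orc A b (snd (snd st))) \<bind>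
     (\<lambda>p. distr (noisy_loss (A p)) borel (\<lambda>v. next_state st (inv \<phi> v)))"
proof -
  have "gaussian \<sigma> \<bind> (\<lambda>\<nu>. return borel (next_state st (A p + inv \<phi> \<nu>))) =
    distr (noisy_loss (A p)) borel (\<lambda>v. next_state st (inv \<phi> v))" for p
  proof -
    have "gaussian \<sigma> \<bind> (\<lambda>\<nu>. return borel (next_state st (A p + inv \<phi> \<nu>))) =
      distr (gaussian \<sigma>) borel (\<lambda>\<nu>. next_state st (A p + inv \<phi> \<nu>))"
      using prob_space.not_empty[OF prob_space_gaussian[OF \<sigma>]] by (intro bind_return_distr') auto
    also have "\<dots> = distr (noisy_loss (A p)) borel (\<lambda>v. next_state st (inv \<phi> v))"
      unfolding noisy_loss_def by (subst distr_distr) (auto simp: comp_def inv_iso_add)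
    finally show ?thesis .
  qed
  then show ?thesis by (simp add: mwu_round_alt)
qed

lemma noisy_loss_props [simp]: "sets (noisy_loss a) = sets borel" "prob_space (noisy_loss a)"
  unfolding noisy_loss_def using prob_space_gaussian[OF \<sigma>]
  by (auto intro: prob_space.prob_space_distr)

lemma loss_kernel:
  "(\<lambda>p. distr (noisy_loss (A p)) borel (\<lambda>v. next_state st (inv \<phi> v))) \<in>
    measure_pmf P \<rightarrow>\<^sub>M prob_algebra borel"
proof -
  have "prob_space (distr (noisy_loss (A p)) borel (\<lambda>v. next_state st (inv \<phi> v)))" for p
    by (intro prob_space.prob_space_distr) (auto cong: measurable_cong_sets)
  then show ?thesis by (auto simp: space_prob_algebra cong: measurable_cong_sets)
qed

lemma mwu_state_prob:
  assumes "\<And>i. (\<lambda>x. pmf (Orc A b x) i) \<in> borel_measurable borel"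
  shows "mstate A t \<in> space (prob_algebra borel)"
proof (induction t)
  case 0
  show ?case by (simp add: space_prob_algebra prob_space_return)
next
  case (Suc t)
  have "(\<lambda>_. mstate A t \<bind> mround A) \<in> count_space UNIV \<rightarrow>\<^sub>M prob_algebra borel"
    by (rule measurable_bind_prob_space[OF _ measurable_mwu_round[OF assms]]) (simp add: Suc)
  from measurable_space[OF this] show ?case by simp
qed

text \<open>
  The iterates thus almost surely lie in the cone of squares, where the oracle is private. The equation
  is used in place of membership in the cone because its measurability is evident.
\<close>
lemma mwu_state_gibbs:
  assumes "\<And>i. (\<lambda>x. pmf (Orc A b x) i) \<in> borel_measurable borel"
  shows "AE st in mstate A t. snd (snd st) = gibbs jprod e \<eta> (fst st)"
proof (cases t)
  case 0
  show ?thesis unfolding 0 mwu_state.simps by (subst AE_return) (auto simp: gibbs_0[OF iso rank])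
next
  case (Suc n)
  have s: "sets (mstate A n) = sets borel" using mwu_state_prob[OF assms] by (simp add: space_prob_algebra)
  have K: "mround A \<in> mstate A n \<rightarrow>\<^sub>M subprob_algebra borel"
    using measurable_prob_algebraD[OF measurable_mwu_round[OF assms]] s by (simp cong: measurable_cong_sets)
  have "Measurable.pred borel (\<lambda>st :: 'a \<times> 'a \<times> 'a. norm (snd (snd st) - gibbs jprod e \<eta> (fst st)) \<le> 0)"
    by measurable
  then have P: "Measurable.pred borel (\<lambda>st :: 'a \<times> 'a \<times> 'a. snd (snd st) = gibbs jprod e \<eta> (fst st))"
    by simp
  have "AE y in distr (noisy_loss a) borel (\<lambda>v. next_state st (inv \<phi> v)).
      snd (snd y) = gibbs jprod e \<eta> (fst y)" for a st
  proof (subst AE_distr_iff)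
    show "(\<lambda>v. next_state st (inv \<phi> v)) \<in> noisy_loss a \<rightarrow>\<^sub>M borel"
      by (auto cong: measurable_cong_sets)
    show "{y \<in> space borel. snd (snd y) = gibbs jprod e \<eta> (fst y)} \<in> sets (borel :: ('a \<times> 'a \<times> 'a) measure)"
      using P by (simp only: pred_def)
  qed (simp add: next_state_def)
  then have "AE y in mround A st. snd (snd y) = gibbs jprod e \<eta> (fst y)" for st
    unfolding mwu_round_distr AE_bind[OF measurable_prob_algebraD[OF loss_kernel] P] by simp
  then show ?thesis
    unfolding Suc mwu_state.simps AE_bind[OF K P] by simp
qed

lemma renyi_bound_mwu_round:
  assumes \<alpha>: "\<alpha> > 1"
    and PQ: "\<And>i. pmf (Orc A b (snd (snd st))) i \<le> exp B * pmf (Orc A' b (snd (snd st))) i"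
    and QP: "\<And>i. pmf (Orc A' b (snd (snd st))) i \<le> exp B * pmf (Orc A b (snd (snd st))) i"
    and dist: "\<And>i. (norm (\<phi> (A i) - \<phi> (A' i)))\<^sup>2 / (2 * \<sigma>\<^sup>2) \<le> \<rho>"
  shows "renyi_bound \<alpha> (B\<^sup>2 / 2 + \<rho>) (mround A st) (mround A' st)"
  unfolding mwu_round_distr
proof (rule renyi_bound_bind[OF \<alpha> renyi_bound_pure_dp[OF \<alpha> PQ QP] _ _ _ loss_kernel loss_kernel])
  have "renyi_bound \<alpha> \<rho> (noisy_loss (A p)) (noisy_loss (A' p))" for p
    unfolding noisy_loss_def by (rule renyi_bound_mono[OF renyi_bound_gaussian[OF \<sigma> \<alpha>] dist \<alpha>])
  then show "AE p in measure_pmf (Orc A b (snd (snd st))).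
      renyi_bound \<alpha> \<rho> (distr (noisy_loss (A p)) borel (\<lambda>v. next_state st (inv \<phi> v)))
        (distr (noisy_loss (A' p)) borel (\<lambda>v. next_state st (inv \<phi> v)))"
    by (intro AE_I2 renyi_bound_distr) (auto cong: measurable_cong_sets)
qed (auto intro: measure_pmf.prob_space_axioms)

lemma renyi_bound_mwu_state:
  assumes \<alpha>: "\<alpha> > 1"
    and meas: "\<And>i. (\<lambda>x. pmf (Orc A b x) i) \<in> borel_measurable borel"
      "\<And>i. (\<lambda>x. pmf (Orc A' b x) i) \<in> borel_measurable borel"
    and PQ: "\<And>x i. x \<in> square_cone jprod \<Longrightarrow> pmf (Orc A b x) i \<le> exp B * pmf (Orc A' b x) i"
    and QP: "\<And>x i. x \<in> square_cone jprod \<Longrightarrow> pmf (Orc A' b x) i \<le> exp B * pmf (Orc A b x) i"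
    and dist: "\<And>i. (norm (\<phi> (A i) - \<phi> (A' i)))\<^sup>2 / (2 * \<sigma>\<^sup>2) \<le> \<rho>"
  shows "renyi_bound \<alpha> (real t * (B\<^sup>2 / 2 + \<rho>)) (mstate A t) (mstate A' t)"
proof (induction t)
  case 0
  show ?case by (simp add: renyi_bound_refl[OF \<alpha>] prob_space_return)
next
  case (Suc t)
  have s: "sets (mstate A t) = sets borel" "sets (mstate A' t) = sets borel"
    and p: "prob_space (mstate A t)" "prob_space (mstate A' t)"
    using mwu_state_prob[of A t, OF meas(1)] mwu_state_prob[of A' t, OF meas(2)] by (auto simp: space_prob_algebra)
  have "renyi_bound \<alpha> (real t * (B\<^sup>2 / 2 + \<rho>) + (B\<^sup>2 / 2 + \<rho>))
    (mstate A t \<bind> mround A) (mstate A' t \<bind> mround A')"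
  proof (rule renyi_bound_bind[OF \<alpha> Suc _ p, where R = borel])
    show "AE st in mstate A t. renyi_bound \<alpha> (B\<^sup>2 / 2 + \<rho>) (mround A st) (mround A' st)"
      using mwu_state_gibbs[of A t, OF meas(1)]
    proof eventually_elim
      case (elim st)
      then have "snd (snd st) \<in> square_cone jprod" using gibbs_in_square_cone[OF iso] by simp
      then show ?case by (intro renyi_bound_mwu_round \<alpha> PQ QP dist)
    qed
  qed (use s measurable_mwu_round meas in \<open>auto cong: measurable_cong_sets\<close>)
  then show ?case by (simp only: of_nat_Suc distrib_right mult_1 mwu_state.simps add.commute)
qed

text \<open>
  The output adds up the iterates \<open>x\<close> of rounds that have already begun, so that the oracle call and the
  noise of the last round have no influence on it.
\<close>
lemma private_mwu_Suc:
  assumes "\<And>i. (\<lambda>x. pmf (Orc A b x) i) \<in> borel_measurable borel"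
  shows "private_mwu jprod e \<phi> Orc r (Suc n) \<eta> \<sigma> b A =
    distr (mstate A n) borel (\<lambda>st. (1 / real (Suc n)) *\<^sub>R (fst (snd st) + snd (snd st)))"
proof -
  let ?h = "\<lambda>st. (1 / real (Suc n)) *\<^sub>R fst (snd st) :: 'a"
  let ?g = "\<lambda>st. (1 / real (Suc n)) *\<^sub>R (fst (snd st) + snd (snd st)) :: 'a"
  have s: "sets (mstate A n) = sets borel" and p: "prob_space (mstate A n)"
    using mwu_state_prob[OF assms] by (simp_all add: space_prob_algebra)
  note ne = prob_space.not_empty[OF p]
  have K: "mround A \<in> mstate A n \<rightarrow>\<^sub>M subprob_algebra borel"
    using measurable_prob_algebraD[OF measurable_mwu_round[OF assms]] s by (simp cong: measurable_cong_sets)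
  have round: "distr (mround A st) borel ?h = return borel (?g st)" for st
  proof -
    have const: "distr (distr (noisy_loss a) borel (\<lambda>v. next_state st (inv \<phi> v))) borel ?h = return borel (?g st)" for a
    proof -
      have "distr (distr (noisy_loss a) borel (\<lambda>v. next_state st (inv \<phi> v))) borel ?h =
        distr (noisy_loss a) borel (\<lambda>v. ?g st)"
        by (subst distr_distr) (auto simp: comp_def next_state_def cong: measurable_cong_sets)
      also have "\<dots> = return borel (?g st)" by (rule prob_space.distr_const) auto
      finally show ?thesis .
    qed
    have "distr (mround A st) borel ?h = measure_pmf (Orc A b (snd (snd st))) \<bind>
      (\<lambda>p. distr (distr (noisy_loss (A p)) borel (\<lambda>v. next_state st (inv \<phi> v))) borel ?h)"
      unfolding mwu_round_distr
      by (rule distr_bind[OF measurable_prob_algebraD[OF loss_kernel]]) auto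
    also have "\<dots> = measure_pmf (Orc A b (snd (snd st))) \<bind> (\<lambda>p. return borel (?g st))"
      by (simp only: const)
    also have "\<dots> = return borel (?g st)"
      by (rule bind_const'[OF measure_pmf.prob_space_axioms])
         (simp add: prob_space_imp_subprob_space prob_space_return)
    finally show ?thesis .
  qed
  have "private_mwu jprod e \<phi> Orc r (Suc n) \<eta> \<sigma> b A = distr (mstate A n \<bind> mround A) borel ?h"
    by (simp add: private_mwu_def split_def)
  also have "\<dots> = mstate A n \<bind> (\<lambda>st. distr (mround A st) borel ?h)"
    by (rule distr_bind[OF K ne]) measurable
  also have "\<dots> = distr (mstate A n) borel ?g"
    unfolding round using ne s by (intro bind_return_distr') (auto cong: measurable_cong_sets)
  finally show ?thesis .
qed

end

end

text \<open>
  The exponent \<open>(\<alpha> - 1) * (\<alpha> * \<rho> - \<epsilon>)\<close> is quadratic in \<open>\<alpha>\<close>. The choice \<open>\<alpha> - 1 = sqrt (L / \<rho>)\<close> with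
  \<open>\<rho> = \<epsilon>\<^sup>2 / (16 * L)\<close> makes it \<open>\<epsilon> / 4 - 3 * L\<close>, which is at most \<open>- L = ln \<delta>\<close> because \<open>\<epsilon> \<le> 8 * L\<close>.
\<close>
lemma dp_parameters:
  fixes \<epsilon> \<delta> :: real
  assumes "\<epsilon> > 0" "0 < \<delta>" "\<delta> < 1" "\<epsilon> \<le> 8 * ln (1 / \<delta>)"
  defines "L \<equiv> ln (1 / \<delta>)"
  defines "\<alpha> \<equiv> 1 + 4 * L / \<epsilon>"
  shows "\<alpha> > 1" "exp ((\<alpha> - 1) * (\<alpha> * (\<epsilon>\<^sup>2 / (16 * L)) - \<epsilon>)) \<le> \<delta>"
proof -
  have L: "L > 0" using assms by (simp add: L_def)
  then show "\<alpha> > 1" using assms by (simp add: \<alpha>_def)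
  have "(\<alpha> - 1) * (\<alpha> * (\<epsilon>\<^sup>2 / (16 * L)) - \<epsilon>) = \<epsilon> / 4 - 3 * L"
    using L assms(1) by (simp add: \<alpha>_def power2_eq_square field_simps)
  also have "\<dots> \<le> - L" using assms(4) by (simp add: L_def)
  also have "- L = ln \<delta>" using assms by (simp add: L_def ln_div)
  finally show "exp ((\<alpha> - 1) * (\<alpha> * (\<epsilon>\<^sup>2 / (16 * L)) - \<epsilon>)) \<le> \<delta>"
    using assms(2) by (metis exp_le_cancel_iff exp_ln)
qed

lemma ln_2_ge_half: "ln (2::real) \<ge> 1 / 2"
proof -
  have "exp (1 / 2 :: real) \<le> 1 + 1 / 2 + (1 / 2)\<^sup>2" by (rule exp_bound) auto
  also have "\<dots> \<le> 2" by (simp add: power2_eq_square)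
  finally show ?thesis using ln_le_cancel_iff[of "exp (1 / 2)" 2] by simp
qed

theorem theoremC7:
  fixes jprod :: "'a::euclidean_space \<Rightarrow> 'a \<Rightarrow> 'a" and e :: 'a
    and \<phi> :: "'a \<Rightarrow> real ^ 'k::finite"
    and Orc :: "('m::finite \<Rightarrow> 'a) \<Rightarrow> ('m \<Rightarrow> real) \<Rightarrow> 'a \<Rightarrow> 'm pmf"
    and r T :: nat
    and \<epsilon> \<delta> \<Delta> \<alpha> \<alpha>\<^sub>0 \<gamma> \<epsilon>' \<eta> \<sigma> :: real
  assumes "euclidean_jordan_algebra jprod e"
    and "has_rank jprod e r"
    and "CARD('k) = DIM('a)"
    and "isometric_iso jprod e \<phi>"
    and "\<epsilon> > 0" and "0 < \<delta>" and "\<delta> < 1" and "\<Delta> > 0" and "\<alpha> > 0"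
    and "\<epsilon> \<le> 8 * ln (1 / \<delta>)"
    and "T = nat \<lceil>144 * ln (real r) / \<alpha>\<^sup>2\<rceil>"
    and "\<epsilon>' = \<epsilon> / (4 * sqrt (real T * ln (1 / \<delta>)))"
    and "\<eta> = \<alpha> / 12"
    and "\<sigma> = \<Delta> * sqrt (2 * real r * ln (real T / \<delta>)) / \<epsilon>'"
    and "dual_oracle jprod e (normalized_constraints jprod e) \<alpha>\<^sub>0 \<gamma> Orc"
    and "private_oracle jprod e (normalized_constraints jprod e) \<Delta> \<epsilon>' Orc"
  shows "low_sensitivity_constraint_private jprod e (normalized_constraints jprod e) \<Delta> \<epsilon> \<delta>
           (private_mwu jprod e \<phi> Orc r T \<eta> \<sigma>)"
proof -
  interpret euclidean_jordan_algebra jprod e by fact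
  note rank = assms(2) and iso = assms(4)
  let ?A = "normalized_constraints jprod e :: ('m \<Rightarrow> 'a) set"
  let ?M = "private_mwu jprod e \<phi> Orc r T \<eta> \<sigma>"
  have meas: "(\<lambda>x. pmf (Orc A b x) i) \<in> borel_measurable borel" if "A \<in> ?A" for A b i
    using assms(15) that by (simp add: dual_oracle_def)
  have r: "r > 0" by (rule rank_pos[OF rank])
  define L where "L = ln (1 / \<delta>)"
  have L: "L > 0" using assms(6,7) by (simp add: L_def)
  consider "T = 0" | n where "T = Suc n" by (cases T) auto
  then show ?thesis
  proof cases
    case 1
    have M0: "?M b A = return borel 0" for b A
      unfolding private_mwu_def 1 by (simp add: distr_return case_prod_beta)
    show ?thesis
      unfolding low_sensitivity_constraint_private_def M0 using assms(5,6)
      by (auto simp: prob_space_return intro!: add_increasing2 mult_right_le_one_le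
        order_trans[OF _ mult_right_mono[of 1 "exp \<epsilon>"]])
  next
    case (2 n)
    define l where "l = ln (real T / \<delta>)"
    have l_pos: "l > 0"
    proof -
      have "real T / \<delta> > 1" using 2 assms(6,7) by (simp add: field_simps)
      then show ?thesis unfolding l_def by (rule ln_gt_zero)
    qed
    have eps': "\<epsilon>' > 0" "real T * \<epsilon>'\<^sup>2 = \<epsilon>\<^sup>2 / (16 * L)"
      using 2 L assms(5) unfolding assms(12) L_def[symmetric]
      by (simp_all add: power_divide power_mult_distrib)
    have \<sigma>: "\<sigma> > 0"
      unfolding assms(14) l_def[symmetric] using assms(8) r l_pos eps' by simp
    note out = private_mwu_Suc[OF iso rank \<sigma>, of Orc, OF meas]
      and state_prob = mwu_state_prob[OF iso rank \<sigma>, of Orc, OF meas]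
    let ?h = "\<lambda>st. (1 / real (Suc n)) *\<^sub>R (fst (snd st) + snd (snd st)) :: 'a"
    let ?S = "\<lambda>b A. mwu_state jprod e \<phi> Orc r \<eta> \<sigma> b A n"
    have S: "prob_space (?S b A)" "sets (?S b A) = sets borel" if "A \<in> ?A" for b A
      using state_prob[OF that] by (simp_all add: space_prob_algebra)
    have h: "?h \<in> ?S b A \<rightarrow>\<^sub>M borel" if "A \<in> ?A" for b A
      using S(2)[OF that] by (simp cong: measurable_cong_sets)
    have M: "prob_space (?M b A)" "sets (?M b A) = sets borel" if "A \<in> ?A" for b A
      unfolding 2 out[OF that] by (rule prob_space.prob_space_distr[OF S(1) h]) (simp_all add: that)
    have "measure (?M b A) X \<le> exp \<epsilon> * measure (?M b A') X + \<delta>"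
      if A: "A \<in> ?A" "A' \<in> ?A" and nb: "neighboring jprod e \<Delta> A A'" and X: "X \<in> sets borel" for b A A' X
    proof (cases "n = 0")
      case True
      then have "?M b A = ?M b A'" unfolding 2 out[OF A(1)] out[OF A(2)] by simp
      moreover have "1 * measure (?M b A') X \<le> exp \<epsilon> * measure (?M b A') X"
        using assms(5) by (intro mult_right_mono) auto
      ultimately show ?thesis using assms(6) by simp
    next
      case False
      define a where "a = 1 + 4 * L / \<epsilon>"
      note a = dp_parameters[OF assms(5-7,10), folded L_def, folded a_def]
      have single: "pmf (Orc B b x) i \<le> exp \<epsilon>' * pmf (Orc B' b x) i"
        if "x \<in> square_cone jprod" "B \<in> ?A" "B' \<in> ?A" "neighboring jprod e \<Delta> B B'" for x i B B'
      proof -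
        have "measure_pmf.prob (Orc B b x) {i} \<le> exp \<epsilon>' * measure_pmf.prob (Orc B' b x) {i}"
          using assms(16) that unfolding private_oracle_def by blast
        then show ?thesis by (simp add: measure_pmf_single)
      qed
      have dist: "(norm (\<phi> (A i) - \<phi> (A' i)))\<^sup>2 / (2 * \<sigma>\<^sup>2) \<le> \<epsilon>'\<^sup>2 / 2" for i
      proof -
        have "ln 2 \<le> l"
        proof -
          have "2 \<le> real T" using 2 False by simp
          also have "real T \<le> real T / \<delta>"
            using assms(6,7) by (simp add: pos_le_divide_eq mult_right_le_one_le)
          finally show ?thesis unfolding l_def by (subst ln_le_cancel_iff) auto
        qed
        then have l: "2 * l \<ge> 1" using ln_2_ge_half by linarith
        have "(norm (\<phi> (A i) - \<phi> (A' i)))\<^sup>2 = (norm (\<phi> (A i - A' i)))\<^sup>2"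
          by (simp add: linear_diff[OF iso_linear(1)[OF iso]])
        also have "\<dots> \<le> real r * (norm_infty jprod e (A i - A' i))\<^sup>2"
          by (rule norm_iso_le_rank_norm_infty[OF iso rank])
        also have "\<dots> \<le> real r * \<Delta>\<^sup>2"
          using nb norm_infty_nonneg by (intro mult_left_mono power_mono) (simp_all add: neighboring_iff)
        also have "\<dots> \<le> real r * \<Delta>\<^sup>2 * (2 * l)"
          using mult_left_mono[OF l, of "real r * \<Delta>\<^sup>2"] by simp
        also have "\<dots> = \<sigma>\<^sup>2 * \<epsilon>'\<^sup>2"
          using eps' l_pos unfolding assms(14) l_def[symmetric] by (simp add: power_divide power_mult_distrib)
        finally show ?thesis using \<sigma> by (simp add: field_simps)
      qed
      have "renyi_bound a (real n * (\<epsilon>'\<^sup>2 / 2 + \<epsilon>'\<^sup>2 / 2)) (?S b A) (?S b A')"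
        using A single neighboring_sym[OF nb] nb dist
        by (intro renyi_bound_mwu_state[OF iso rank \<sigma> a(1)] meas) auto
      then have "renyi_bound a (\<epsilon>\<^sup>2 / (16 * L)) (?S b A) (?S b A')"
        by (rule renyi_bound_mono[OF _ _ a(1)]) (simp add: 2 eps'(2)[symmetric] mult_right_mono)
      then have "renyi_bound a (\<epsilon>\<^sup>2 / (16 * L)) (?M b A) (?M b A')"
        unfolding 2 out[OF A(1)] out[OF A(2)]
        by (rule renyi_bound_distr) (use S h A in auto)
      then show ?thesis
        using M A X a by (intro renyi_bound_imp_dp[OF a(1) _ _ _ _ a(2)]) auto
    qed
    then show ?thesis
      unfolding low_sensitivity_constraint_private_def using M by blast
  qed
qed

end
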